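(* Let $\ell>0$, let $\delta>0$ and let $g(h)=\big|\ln|h|\big|^\delta$. Then there exist $u_0\in H^1(\mathbb{R})\cap W^{1,\infty}(\mathbb{R})$, $T>0$ and a compact set $\mathcal{K}\subset\mathbb{R}$ such that there exists a solution $u$ of the regularised Burgers equation $u_t+u\,u_x+\ell^2P_x=0$ with $u(0,\cdot)=u_0$ satisfying $$\int_{\mathbb{R}}u_0'(x)^2\,g(u_0'(x))\,\mathrm{d}x<+\infty,\qquad\int_{\mathcal{K}}u_x(T,x)^2\,g(u_x(T,x))\,\mathrm{d}x=+\infty .$$
   Context: $P=\mathfrak{G}\ast\tfrac12u_x^2$ (convolution in $x$) with $\mathfrak{G}(x)=(2\ell)^{-1}\exp(-|x|/\ell)$. A solution on $[0,T]$ is a function $u\in\mathrm{Lip}([0,T],L^2_{\rm loc}(\mathbb{R}))$ with $u_x\in L^\infty([0,T],L^2_{\rm loc}(\mathbb{R}))$ satisfying the equation in the weak sense; $u_x(T,\cdot)$ is the derivative of $u(T,\cdot)$. The expression $h^2g(h)$ is taken to be $0$ at $h=0$. *)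

theory Defs
  imports "HOL-Analysis.Analysis"
begin

text \<open>
  Elements of the function spaces below are represented by Borel measurable functions; two
  representatives are identified when they agree almost everywhere, so equalities between them
  are stated almost everywhere.
\<close>

subsection \<open>Test functions and weak derivatives\<close>

text \<open>
  \<open>C\<^sup>\<infinity>\<close> functions: the largest class of (Frechet) differentiable functions that is closed under
  taking directional derivatives.
\<close>

coinductive smooth :: "('a::real_normed_vector \<Rightarrow> real) \<Rightarrow> bool" where
  "(\<And>x. \<phi> differentiable (at x)) \<Longrightarrow> (\<And>b. smooth (\<lambda>x. frechet_derivative \<phi> (at x) b)) \<Longrightarrow> smooth \<phi>"

definition test_function_on :: "'a::euclidean_space set \<Rightarrow> ('a \<Rightarrow> real) \<Rightarrow> bool" where
  "test_function_on U \<phi> \<longleftrightarrow>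
     smooth \<phi> \<and> compact (closure {x. \<phi> x \<noteq> 0}) \<and> closure {x. \<phi> x \<noteq> 0} \<subseteq> U"

definition loc_integrable_on :: "'a::euclidean_space set \<Rightarrow> ('a \<Rightarrow> real) \<Rightarrow> bool" where
  "loc_integrable_on U f \<longleftrightarrow> (\<forall>K. compact K \<and> K \<subseteq> U \<longrightarrow> set_integrable lborel K f)"

definition has_weak_deriv :: "(real \<Rightarrow> real) \<Rightarrow> (real \<Rightarrow> real) \<Rightarrow> bool" where
  "has_weak_deriv f f' \<longleftrightarrow>
     loc_integrable_on UNIV f \<and> loc_integrable_on UNIV f' \<and>
     (\<forall>\<phi>. test_function_on UNIV \<phi> \<longrightarrow>
        (\<integral>x. f x * deriv \<phi> x \<partial>lborel) = - (\<integral>x. f' x * \<phi> x \<partial>lborel))"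

subsection \<open>Function spaces on the real line\<close>

definition L2 :: "(real \<Rightarrow> real) set" where
  "L2 = {f \<in> borel_measurable borel. integrable lborel (\<lambda>x. (f x)\<^sup>2)}"

definition Linf :: "(real \<Rightarrow> real) set" where
  "Linf = {f \<in> borel_measurable borel. \<exists>C. AE x in lborel. \<bar>f x\<bar> \<le> C}"

definition H1 :: "(real \<Rightarrow> real) set" where
  "H1 = {f \<in> L2. \<exists>f' \<in> L2. has_weak_deriv f f'}"

definition W1inf :: "(real \<Rightarrow> real) set" where
  "W1inf = {f \<in> Linf. \<exists>f' \<in> Linf. has_weak_deriv f f'}"

definition L2_loc :: "(real \<Rightarrow> real) set" where
  "L2_loc = {f \<in> borel_measurable borel. \<forall>K. compact K \<longrightarrow> set_integrable lborel K (\<lambda>x. (f x)\<^sup>2)}"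

definition L2_norm_on :: "real set \<Rightarrow> (real \<Rightarrow> real) \<Rightarrow> real" where
  "L2_norm_on K f = sqrt (\<integral>x\<in>K. (f x)\<^sup>2 \<partial>lborel)"

subsection \<open>Functions of time with values in \<open>L\<^sup>2\<^sub>l\<^sub>o\<^sub>c\<close>\<close>

text \<open>
  \<open>L\<^sup>2\<^sub>l\<^sub>o\<^sub>c\<close> carries the seminorms \<open>L2_norm_on K\<close>, so the Lipschitz constant, respectively the
  essential bound, may depend on \<open>K\<close>. A map of time into \<open>L\<^sup>2\<^sub>l\<^sub>o\<^sub>c\<close> is given by a jointly measurable
  function \<open>u t x\<close>.
\<close>

definition jointly_measurable :: "real \<Rightarrow> (real \<Rightarrow> real \<Rightarrow> real) \<Rightarrow> bool" where
  "jointly_measurable T u \<longleftrightarrow>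
     (\<lambda>(t, x). u t x) \<in> borel_measurable (restrict_space borel ({0..T} \<times> UNIV))"

definition Lip_L2_loc :: "real \<Rightarrow> (real \<Rightarrow> real \<Rightarrow> real) set" where
  "Lip_L2_loc T = {u. jointly_measurable T u \<and> (\<forall>t\<in>{0..T}. u t \<in> L2_loc) \<and>
     (\<forall>K. compact K \<longrightarrow> (\<exists>C. \<forall>s\<in>{0..T}. \<forall>t\<in>{0..T}.
        L2_norm_on K (\<lambda>x. u t x - u s x) \<le> C * \<bar>t - s\<bar>))}"

definition Linf_L2_loc :: "real \<Rightarrow> (real \<Rightarrow> real \<Rightarrow> real) set" where
  "Linf_L2_loc T = {v. jointly_measurable T v \<and> (AE t\<in>{0..T} in lborel. v t \<in> L2_loc) \<and>
     (\<forall>K. compact K \<longrightarrow> (\<exists>C. AE t\<in>{0..T} in lborel. L2_norm_on K (v t) \<le> C))}"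

subsection \<open>The regularised Burgers equation\<close>

definition green :: "real \<Rightarrow> real \<Rightarrow> real" where
  "green l x = exp (- \<bar>x\<bar> / l) / (2 * l)"

definition rB_P :: "real \<Rightarrow> (real \<Rightarrow> real) \<Rightarrow> real \<Rightarrow> real" where
  "rB_P l v x = (\<integral>y. green l (x - y) * ((v y)\<^sup>2 / 2) \<partial>lborel)"

text \<open>
  The equation is understood in the sense of distributions on \<open>(0,T) \<times> \<real>\<close>. For this \<open>P\<close> has to be
  a distribution: since \<open>u\<^sub>x(t,\<cdot>)\<close> is only locally square integrable, convergence of the convolution
  integral and local integrability of \<open>P\<close> are part of the definition (a divergent
  integral would otherwise have the value \<open>0\<close>). The products \<open>u \<phi>\<^sub>t\<close> and \<open>u u\<^sub>x \<phi>\<close> are integrable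
  by the regularity required of \<open>u\<close> and \<open>u\<^sub>x\<close>.
\<close>

definition rB_weak_equation ::
  "real \<Rightarrow> real \<Rightarrow> (real \<Rightarrow> real \<Rightarrow> real) \<Rightarrow> (real \<Rightarrow> real \<Rightarrow> real) \<Rightarrow> bool" where
  "rB_weak_equation l T u u\<^sub>x \<longleftrightarrow>
     (AE t\<in>{0..T} in lborel. \<forall>x. integrable lborel (\<lambda>y. green l (x - y) * ((u\<^sub>x t y)\<^sup>2 / 2))) \<and>
     loc_integrable_on ({0<..<T} \<times> UNIV) (\<lambda>(t, x). rB_P l (u\<^sub>x t) x) \<and>
     (\<forall>\<phi>. test_function_on ({0<..<T} \<times> UNIV) \<phi> \<longrightarrow>
        integral\<^sup>L lborel (\<lambda>(t, x).
            - u t x * deriv (\<lambda>s. \<phi> (s, x)) t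
            + u t x * u\<^sub>x t x * \<phi> (t, x)
            - l\<^sup>2 * rB_P l (u\<^sub>x t) x * deriv (\<lambda>y. \<phi> (t, y)) x) = 0)"

definition rB_solution :: "real \<Rightarrow> real \<Rightarrow> (real \<Rightarrow> real \<Rightarrow> real) \<Rightarrow> bool" where
  "rB_solution l T u \<longleftrightarrow>
     u \<in> Lip_L2_loc T \<and>
     (\<exists>u\<^sub>x \<in> Linf_L2_loc T.
        (AE t\<in>{0..T} in lborel. has_weak_deriv (u t) (u\<^sub>x t)) \<and>
        rB_weak_equation l T u u\<^sub>x)"

text \<open>At \<open>h = 0\<close> the value is irrelevant: only \<open>h\<^sup>2 g(h)\<close> is used, which is then \<open>0\<close>.\<close>

definition log_weight :: "real \<Rightarrow> real \<Rightarrow> real" where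
  "log_weight \<delta> h = \<bar>ln \<bar>h\<bar>\<bar> powr \<delta>"

end

theory Submission
  imports Defs
begin

text \<open>
  Along characteristics \<open>v = u\<^sub>x\<close> satisfies \<open>v' = - v\<^sup>2 / 2 - P\<close>. If the Jacobian of the flow is written
  as \<open>A\<^sup>2\<close> and \<open>v = 2 A' / A\<close>, this becomes the linear equation \<open>A'' = - (P / 2) A\<close>, which does not
  notice the blow-up of \<open>v\<close>; the energy \<open>v\<^sup>2 dx\<close> is \<open>4 A'\<^sup>2 d\<xi>\<close>. The equation is invariant under
  \<open>(t, u) \<mapsto> (- t, - u)\<close>, so one prescribes the singular profile at the final time \<open>T\<close> and solves
  backwards, with \<open>s = T - t\<close> and \<open>B = A\<^sub>s\<close>: at \<open>s = 0\<close> the function \<open>A\<close> vanishes at \<open>\<xi> = 0\<close> only, but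
  so fast that \<open>4 B\<^sup>2 \<bar>ln (2 B / A)\<bar>\<^sup>\<delta>\<close> is not integrable, while \<open>B > 0\<close> there makes \<open>A\<close> bounded
  below for \<open>s > 0\<close>. For even \<open>A\<close> and \<open>B\<close> the flow is odd in \<open>\<xi>\<close>, so \<open>Y s \<xi>\<close> is the integral of \<open>A\<^sup>2\<close> over
  \<open>{0..\<xi>}\<close> and \<open>B\<close> is the only unknown; it is found by a contraction in the space of functions
  bounded by \<open>exp (- \<bar>\<xi>\<bar> / (8 l))\<close>, for short time. Then \<open>u\<close> is the velocity of the flow
  \<open>t \<mapsto> Y (T - t)\<close>.
\<close>

subsection \<open>Preliminaries\<close>

text \<open>The equation for \<open>v\<close> comes from differentiating the equation for
  \<open>u\<close> in \<open>x\<close> and eliminating \<open>P_xx\<close> through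
  \<open>P - l^2 P_xx = v^2 / 2\<close>, the defining property of the Green kernel. The obstacle is
  that \<open>v\<close> is unbounded near the final time, so no uniform-in-time estimate may use its
  supremum. In the variable \<xi> it enters only through \<open>A^2 v\<close>, which is continuous,
  and \<open>A^2 v^2\<close>, which is integrable; hence the changes of variables throughout, and
  the Lipschitz bound in time rests on the energy alone. The nonlocal term requires decay in \<xi>:
  the flow separates far points at rate at least 1/4, which fixes the rate 1/8 of the weight, half
  of the decay of the kernel being kept in reserve. For \<open>u 0\<close> to lie in L2 the velocity
  must decay as well. Therefore \<open>B0\<close> is corrected away from the origin until the final
  velocity has compact support; at other times the pressure gradient, dominated by
  \<open>P / l\<close>, adds only decaying terms.\<close>

lemma continuous_on_Pair_compose:
  assumes "continuous_on UNIV (\<lambda>(x, y). f x y)" "continuous_on S a" "continuous_on S b"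
  shows "continuous_on S (\<lambda>z. f (a z) (b z))"
  using continuous_on_compose2[OF assms(1) continuous_on_Pair[OF assms(2,3)]] by simp

text \<open>The integral from \<open>0\<close> to \<open>x\<close>, for either sign of \<open>x\<close>; the rescaling to \<open>{0..1}\<close> makes the
  theorems on integrals depending on a parameter applicable to the endpoint as well.\<close>

definition prim :: "(real \<Rightarrow> real) \<Rightarrow> real \<Rightarrow> real" where
  "prim f x = x * integral {0..1} (\<lambda>\<sigma>. f (x * \<sigma>))"

text \<open>Fundamental theorem of calculus. It is the standard way below to evaluate a
  \<open>prim\<close>: guess an antiderivative, differentiate it, compare at 0.\<close>

lemma prim_eq:
  assumes F: "\<And>x. (F has_real_derivative f x) (at x)"
  shows "prim f x = F x - F 0"
proof -
  have "((\<lambda>\<sigma>. x * f (x * \<sigma>)) has_integral (F (x * 1) - F (x * 0))) {0..1}"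
  proof (rule fundamental_theorem_of_calculus)
    show "((\<lambda>\<sigma>. F (x * \<sigma>)) has_vector_derivative x * f (x * \<sigma>)) (at \<sigma> within {0..1})" for \<sigma>
      unfolding has_real_derivative_iff_has_vector_derivative[symmetric]
      by (rule DERIV_subset[OF _ subset_UNIV])
        (use DERIV_chain2[OF F DERIV_cmult_Id, of x \<sigma> UNIV] in \<open>simp add: mult.commute\<close>)
  qed simp
  then have "((\<lambda>\<sigma>. x * f (x * \<sigma>)) has_integral (F x - F 0)) {0..1}"
    by simp
  then show ?thesis
    unfolding prim_def Henstock_Kurzweil_Integration.integral_mult_right[symmetric]
    by (rule integral_unique)
qed

lemma has_real_derivative_prim:
  assumes "continuous_on UNIV f"
  shows "(prim f has_real_derivative f x) (at x)"
proof -
  have "\<exists>F. \<forall>x. -\<infinity> < ereal x \<longrightarrow> ereal x < \<infinity> \<longrightarrow> (F has_vector_derivative f x) (at x)"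
    by (rule einterval_antiderivative)
      (use assms in \<open>auto simp: continuous_on_eq_continuous_at\<close>)
  then obtain F where "\<And>x. (F has_real_derivative f x) (at x)"
    by (auto simp: has_real_derivative_iff_has_vector_derivative)
  moreover from this have "prim f = (\<lambda>x. F x - F 0)"
    by (auto simp: prim_eq)
  ultimately show ?thesis
    by (auto intro!: derivative_eq_intros)
qed

lemma continuous_on_prim:
  assumes "continuous_on UNIV f"
  shows "continuous_on S (prim f)"
  by (intro continuous_at_imp_continuous_on ballI DERIV_isCont[OF has_real_derivative_prim[OF assms]])

lemma prim_0 [simp]: "prim f 0 = 0"
  by (simp add: prim_def)

lemma continuous_on_prim_param:
  fixes f :: "'a::topological_space \<Rightarrow> real \<Rightarrow> real"
  assumes "continuous_on UNIV (\<lambda>(p, x). f p x)"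
  shows "continuous_on UNIV (\<lambda>(p, x). prim (f p) x)"
proof -
  have "continuous_on UNIV (\<lambda>px. integral (cbox 0 (1::real)) (\<lambda>\<sigma>. f (fst px) (snd px * \<sigma>)))"
    by (rule integral_continuous_on_param)
      (auto simp: split_beta intro!: continuous_intros continuous_on_Pair_compose[OF assms])
  then show ?thesis
    by (auto simp: prim_def split_beta intro!: continuous_intros)
qed

text \<open>Differentiation under the integral sign. The set \<open>U\<close> will be the open time
  interval, since clamping may destroy differentiability at its ends.\<close>

lemma has_real_derivative_prim_param:
  fixes f f' :: "real \<Rightarrow> real \<Rightarrow> real"
  assumes U: "open U" "convex U" "p \<in> U"
    and d: "\<And>p x. p \<in> U \<Longrightarrow> ((\<lambda>p. f p x) has_real_derivative f' p x) (at p)"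
    and cf: "\<And>p. p \<in> U \<Longrightarrow> continuous_on UNIV (f p)"
    and cf': "continuous_on (U \<times> UNIV) (\<lambda>(p, x). f' p x)"
  shows "((\<lambda>p. prim (f p) x) has_real_derivative prim (f' p) x) (at p)"
proof -
  have "((\<lambda>p. integral (cbox 0 (1::real)) (\<lambda>\<sigma>. f p (x * \<sigma>))) has_field_derivative
      integral (cbox 0 1) (\<lambda>\<sigma>. f' p (x * \<sigma>))) (at p within U)"
  proof (rule leibniz_rule_field_derivative)
    show "((\<lambda>p. f p (x * \<sigma>)) has_real_derivative f' p (x * \<sigma>)) (at p within U)" if "p \<in> U" for p \<sigma>
      using d[OF that] by (rule DERIV_subset) simp
    show "(\<lambda>\<sigma>. f p (x * \<sigma>)) integrable_on cbox 0 1" if "p \<in> U" for p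
      by (rule integrable_continuous) (intro continuous_intros continuous_on_compose2[OF cf[OF that]], simp)
    show "continuous_on (U \<times> cbox 0 1) (\<lambda>(p, \<sigma>). f' p (x * \<sigma>))"
      unfolding split_beta
      by (rule continuous_on_compose2[OF cf'[unfolded split_beta], of _ "\<lambda>q. (fst q, x * snd q)", simplified])
        (auto intro!: continuous_intros)
  qed (use U in auto)
  then have "((\<lambda>p. x * integral (cbox 0 (1::real)) (\<lambda>\<sigma>. f p (x * \<sigma>))) has_field_derivative
      x * integral (cbox 0 1) (\<lambda>\<sigma>. f' p (x * \<sigma>))) (at p)"
    using at_within_open[OF U(3,1)] by (intro DERIV_cmult) simp
  then show ?thesis
    by (simp add: prim_def)
qed

lemma DERIV_bound_diff:
  fixes g :: "real \<Rightarrow> real"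
  assumes "\<And>x. (g has_real_derivative g' x) (at x)" "\<And>x. \<bar>g' x\<bar> \<le> C"
  shows "\<bar>g x - g y\<bar> \<le> C * \<bar>x - y\<bar>"
  using field_differentiable_bound[of UNIV g g' C x y] assms by simp

lemma abs_prim_le:
  assumes "continuous_on UNIV f" "\<And>y. \<bar>f y\<bar> \<le> C"
  shows "\<bar>prim f x\<bar> \<le> C * \<bar>x\<bar>"
  using DERIV_bound_diff[OF has_real_derivative_prim[OF assms(1)] assms(2), of x 0] by simp

lemma prim_diff:
  assumes "continuous_on UNIV f" "continuous_on UNIV g"
  shows "prim (\<lambda>y. f y - g y) x = prim f x - prim g x"
  by (subst prim_eq[where F = "\<lambda>x. prim f x - prim g x"])
    (auto intro!: derivative_eq_intros has_real_derivative_prim assms)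

lemma prim_uminus:
  assumes "continuous_on UNIV f"
  shows "prim (\<lambda>y. f (- y)) x = - prim f (- x)"
  by (subst prim_eq[where F = "\<lambda>x. - prim f (- x)"])
    (auto intro!: derivative_eq_intros DERIV_chain2[OF has_real_derivative_prim] assms)

section \<open>Change of variables along a monotone bijection\<close>

text \<open>Bijectivity makes the nondecreasing \<open>Y\<close> strictly increasing, so the
  preimage of an interval is an interval and its weighted measure is the increment of
  \<open>Y\<close>. The density may have zeros, as the Jacobian does at the origin at the final
  time.\<close>

lemma lborel_distr_density:
  fixes Y D :: "real \<Rightarrow> real"
  assumes D: "\<And>x. (Y has_real_derivative D x) (at x)" "continuous_on UNIV D" "\<And>x. D x \<ge> 0"
    and bij: "bij Y"
  shows "distr (density lborel (\<lambda>x. ennreal (D x))) borel Y = lborel"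
proof (rule lborel_eqI[symmetric])
  have [measurable]: "D \<in> borel_measurable borel"
    by (rule borel_measurable_continuous_onI) fact
  have "continuous_on UNIV Y"
    using D(1) by (meson DERIV_isCont continuous_at_imp_continuous_on)
  then have [measurable]: "Y \<in> borel_measurable borel"
    by (rule borel_measurable_continuous_onI)
  have mono: "x \<le> y \<Longrightarrow> Y x \<le> Y y" for x y
    using D by (intro DERIV_nonneg_imp_nondecreasing[of x y Y]) auto
  then have less: "Y x < Y y \<longleftrightarrow> x < y" for x y
    using bij by (metis bij_is_inj inj_eq linorder_not_less order_less_le)
  fix l u :: real assume "\<And>b. b \<in> Basis \<Longrightarrow> l \<bullet> b \<le> u \<bullet> b"
  then have "l \<le> u" by simp
  obtain a b where ab: "l = Y a" "u = Y b"
    using bij by (metis bij_pointE)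
  have "a \<le> b" using less[of b a] \<open>l \<le> u\<close> ab by force
  have "emeasure (distr (density lborel (\<lambda>x. ennreal (D x))) borel Y) (box l u)
      = emeasure (density lborel (\<lambda>x. ennreal (D x))) {a<..<b}"
    using less by (subst emeasure_distr) (auto simp: ab intro!: arg_cong2[where f=emeasure])
  also have "\<dots> = (\<integral>\<^sup>+x. ennreal (D x) * indicator {a<..<b} x \<partial>lborel)"
    by (subst emeasure_density) auto
  also have "\<dots> = (\<integral>\<^sup>+x. ennreal (D x) * indicator {a..b} x \<partial>lborel)"
    by (rule nn_integral_cong_AE, use AE_lborel_singleton[of a] AE_lborel_singleton[of b] in eventually_elim)
      (auto split: split_indicator)
  also have "\<dots> = ennreal (Y b - Y a)"
    by (rule nn_integral_FTC_Icc) (use D \<open>a \<le> b\<close> in auto)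
  finally show "emeasure (distr (density lborel (\<lambda>x. ennreal (D x))) borel Y) (box l u) = (\<Prod>b\<in>Basis. (u - l) \<bullet> b)"
    by (simp add: ab)
qed simp

text \<open>By Fubini this is the one-dimensional statement at each fixed \<open>t\<close>; it
  transports space-time integrals to Lagrangian coordinates.\<close>

lemma lborel_distr_density_fibre:
  fixes Y D :: "real \<Rightarrow> real \<Rightarrow> real"
  assumes D: "\<And>t x. (Y t has_real_derivative D t x) (at x)" "continuous_on UNIV (\<lambda>(t, x). D t x)"
      "\<And>t x. D t x \<ge> 0"
    and bij: "\<And>t. bij (Y t)" and Y: "continuous_on UNIV (\<lambda>(t, x). Y t x)"
  shows "distr (density lborel (\<lambda>(t, x). ennreal (D t x))) borel (\<lambda>(t, x). (t, Y t x)) = lborel"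
proof (rule measure_eqI)
  have mD [measurable]: "case_prod D \<in> borel_measurable (borel \<Otimes>\<^sub>M borel)"
    using borel_measurable_continuous_onI[OF D(2)] by (simp add: borel_prod)
  have mY [measurable]: "case_prod Y \<in> borel_measurable (borel \<Otimes>\<^sub>M borel)"
    using borel_measurable_continuous_onI[OF Y] by (simp add: borel_prod)
  have mP: "(\<lambda>(t, x). (t, Y t x)) \<in> (borel \<Otimes>\<^sub>M borel) \<rightarrow>\<^sub>M (borel \<Otimes>\<^sub>M borel)"
    by measurable
  fix S assume "S \<in> sets (distr (density lborel (\<lambda>(t, x). ennreal (D t x))) borel (\<lambda>(t, x). (t, Y t x)))"
  then have S': "S \<in> sets borel" by (simp only: sets_distr)
  then have S: "S \<in> sets (borel \<Otimes>\<^sub>M borel)" by (simp only: borel_prod)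
  have mI [measurable]: "indicator S \<in> borel_measurable (borel \<Otimes>\<^sub>M borel)"
    using S by simp
  have "emeasure (distr (density lborel (\<lambda>(t, x). ennreal (D t x))) borel (\<lambda>(t, x). (t, Y t x))) S
    = (\<integral>\<^sup>+p. indicator S p \<partial>distr (density lborel (\<lambda>(t, x). ennreal (D t x))) borel (\<lambda>(t, x). (t, Y t x)))"
    using S' by (subst nn_integral_indicator) (simp_all only: sets_distr)
  also have "\<dots> = (\<integral>\<^sup>+p. (case p of (t, x) \<Rightarrow> ennreal (D t x) * indicator S (t, Y t x)) \<partial>(lborel \<Otimes>\<^sub>M lborel))"
  proof (subst nn_integral_distr)
    show "(\<lambda>(t, x). (t, Y t x)) \<in> density lborel (\<lambda>(t, x). ennreal (D t x)) \<rightarrow>\<^sub>M borel"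
      using mP by (simp add: borel_prod)
    show "integral\<^sup>N (density lborel (\<lambda>(t, x). ennreal (D t x))) (\<lambda>x. indicator S (case x of (t, x) \<Rightarrow> (t, Y t x))) =
      (\<integral>\<^sup>+p. (case p of (t, x) \<Rightarrow> ennreal (D t x) * indicator S (t, Y t x)) \<partial>(lborel \<Otimes>\<^sub>M lborel))"
      unfolding lborel_prod[symmetric]
      by (subst nn_integral_density) (auto simp: split_beta intro!: nn_integral_cong)
  qed (use mI in \<open>simp add: borel_prod\<close>)
  also have "\<dots> = (\<integral>\<^sup>+t. \<integral>\<^sup>+x. ennreal (D t x) * indicator S (t, Y t x) \<partial>lborel \<partial>lborel)"
    by (subst lborel.nn_integral_fst[symmetric]) auto
  also have "\<dots> = (\<integral>\<^sup>+t. \<integral>\<^sup>+x. indicator S (t, x) \<partial>lborel \<partial>lborel)"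
  proof (rule nn_integral_cong)
    fix t
    have cD: "continuous_on UNIV (D t)"
      by (intro continuous_on_Pair_compose[OF D(2)] continuous_intros)
    have [measurable]: "D t \<in> borel_measurable borel"
      by (rule borel_measurable_continuous_onI) fact
    have [measurable]: "Y t \<in> borel_measurable borel"
      using D(1) by (intro borel_measurable_continuous_onI) (meson DERIV_isCont continuous_at_imp_continuous_on)
    have "(\<integral>\<^sup>+x. indicator S (t, x) \<partial>lborel)
      = (\<integral>\<^sup>+x. indicator S (t, x) \<partial>distr (density lborel (\<lambda>x. ennreal (D t x))) borel (Y t))"
      by (subst lborel_distr_density[OF D(1) cD D(3) bij]) simp
    also have "\<dots> = (\<integral>\<^sup>+x. ennreal (D t x) * indicator S (t, Y t x) \<partial>lborel)"
      by (subst nn_integral_distr, simp, simp, subst nn_integral_density) auto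
    finally show "(\<integral>\<^sup>+x. ennreal (D t x) * indicator S (t, Y t x) \<partial>lborel) = (\<integral>\<^sup>+x. indicator S (t, x) \<partial>lborel)"
      by simp
  qed
  also have "\<dots> = (\<integral>\<^sup>+p. indicator S p \<partial>(lborel \<Otimes>\<^sub>M lborel))"
    by (subst lborel.nn_integral_fst) auto
  also have "\<dots> = emeasure lborel S"
    using S' by (simp add: lborel_prod)
  finally show "emeasure (distr (density lborel (\<lambda>(t, x). ennreal (D t x))) borel (\<lambda>(t, x). (t, Y t x))) S = emeasure lborel S" .
qed simp

section \<open>Integrals of compactly supported derivatives\<close>

lemma integral_deriv_compact_support:
  fixes f F :: "real \<Rightarrow> real"
  assumes "\<And>x. (F has_real_derivative f x) (at x)" "continuous_on UNIV f"
    and "compact K" "\<And>x. x \<notin> K \<Longrightarrow> F x = 0" "\<And>x. x \<notin> K \<Longrightarrow> f x = 0"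
  shows "(\<integral>x. f x \<partial>lborel) = 0"
proof -
  obtain N where N: "N > 0" "\<And>x. x \<in> K \<Longrightarrow> \<bar>x\<bar> < N"
    using compact_imp_bounded[OF assms(3)] bounded_pos_less by (metis real_norm_def)
  have "(\<integral>x. f x \<partial>lborel) = (\<integral>x. f x * indicator {-N..N} x \<partial>lborel)"
    using N assms(5) by (intro Bochner_Integration.integral_cong) (fastforce split: split_indicator)+
  also have "\<dots> = F N - F (-N)"
    by (rule integral_FTC_Icc_real) (use N assms in \<open>auto simp: continuous_on_eq_continuous_at\<close>)
  also have "\<dots> = 0" using N(2)[of N] N(2)[of "-N"] N(1) assms(4) by force
  finally show ?thesis .
qed

lemma integrable_compact_support:
  fixes f :: "'a::euclidean_space \<Rightarrow> real"
  assumes "continuous_on UNIV f" "compact K" "\<And>x. x \<notin> K \<Longrightarrow> f x = 0"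
  shows "integrable lborel f"
proof -
  have "integrable lborel (\<lambda>x. indicator K x *\<^sub>R f x)"
    by (rule borel_integrable_compact) (use assms in \<open>auto intro: continuous_on_subset\<close>)
  also have "(\<lambda>x. indicator K x *\<^sub>R f x) = f"
    using assms(3) by (auto split: split_indicator)
  finally show ?thesis .
qed

text \<open>Fubini with the differentiated variable innermost. Together with its twin for the other
  variable it makes the integral of a divergence vanish.\<close>

lemma integral_partial_deriv1_compact_support:
  fixes f F :: "real \<Rightarrow> real \<Rightarrow> real"
  assumes d: "\<And>x y. ((\<lambda>x. F x y) has_real_derivative f x y) (at x)"
    and c: "continuous_on UNIV (\<lambda>(x, y). f x y)" and K: "compact K"
    and 0: "\<And>x y. (x, y) \<notin> K \<Longrightarrow> F x y = 0" "\<And>x y. (x, y) \<notin> K \<Longrightarrow> f x y = 0"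
  shows "(\<integral>p. (case p of (x, y) \<Rightarrow> f x y) \<partial>lborel) = 0"
proof -
  have i: "integrable (lborel \<Otimes>\<^sub>M lborel) (\<lambda>(x, y). f x y)"
    unfolding lborel_prod using 0 by (intro integrable_compact_support[OF c K]) auto
  have "(\<integral>x. f x y \<partial>lborel) = 0" for y
  proof (rule integral_deriv_compact_support[OF d])
    show "continuous_on UNIV (\<lambda>x. f x y)"
      by (intro continuous_on_Pair_compose[OF c] continuous_intros)
    show "compact (fst ` K)" by (intro compact_continuous_image K continuous_intros)
  qed (use 0 in force)+
  with lborel_pair.integral_snd[OF i] show ?thesis by (simp add: lborel_prod)
qed

lemma integral_partial_deriv2_compact_support:
  fixes f F :: "real \<Rightarrow> real \<Rightarrow> real"
  assumes d: "\<And>x y. ((\<lambda>y. F x y) has_real_derivative f x y) (at y)"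
    and c: "continuous_on UNIV (\<lambda>(x, y). f x y)" and K: "compact K"
    and 0: "\<And>x y. (x, y) \<notin> K \<Longrightarrow> F x y = 0" "\<And>x y. (x, y) \<notin> K \<Longrightarrow> f x y = 0"
  shows "(\<integral>p. (case p of (x, y) \<Rightarrow> f x y) \<partial>lborel) = 0"
proof -
  have i: "integrable (lborel \<Otimes>\<^sub>M lborel) (\<lambda>(x, y). f x y)"
    unfolding lborel_prod using 0 by (intro integrable_compact_support[OF c K]) auto
  have "(\<integral>y. f x y \<partial>lborel) = 0" for x
  proof (rule integral_deriv_compact_support[OF d])
    show "continuous_on UNIV (\<lambda>y. f x y)"
      by (intro continuous_on_Pair_compose[OF c] continuous_intros)
    show "compact (snd ` K)" by (intro compact_continuous_image K continuous_intros)
  qed (use 0 in force)+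
  with lborel_pair.integral_fst[OF i] show ?thesis by (simp add: lborel_prod)
qed

section \<open>The exponential weight\<close>

text \<open>The rate is such that the kernel between two points of the flow is at most a constant
  times \<open>(rho l (\<xi> - \<eta>))\<^sup>2\<close>, see \<open>exp_pos_le\<close>. One of the
  two factors moves decay from \<eta> to \<xi>, the other absorbs a linear factor in the contraction
  estimate.\<close>

definition rho :: "real \<Rightarrow> real \<Rightarrow> real" where
  "rho l \<xi> = exp (- \<bar>\<xi>\<bar> / (8 * l))"

lemma rho_pos [simp]: "0 < rho l \<xi>" "0 \<le> rho l \<xi>" "rho l \<xi> \<noteq> 0"
  by (simp_all add: rho_def)

lemma rho_minus [simp]: "rho l (- \<xi>) = rho l \<xi>"
  by (simp add: rho_def)

lemma rho_le_1: "l > 0 \<Longrightarrow> rho l \<xi> \<le> 1"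
  by (simp add: rho_def)

lemma continuous_on_rho [continuous_intros]: "continuous_on S f \<Longrightarrow> continuous_on S (\<lambda>x. rho l (f x))"
  unfolding rho_def divide_inverse by (intro continuous_intros)

lemma measurable_rho [measurable]: "rho l \<in> borel_measurable borel"
  by (intro borel_measurable_continuous_onI continuous_intros)

lemma integrable_rho:
  assumes "l > 0"
  shows "integrable lborel (rho l)"
proof (rule integrableI_nonneg)
  define c where "c = 8 * l"
  have c: "c > 0" using assms by (simp add: c_def)
  define h where "h = (\<lambda>x. ennreal (exp (- x / c)) * indicator {0..} x)"
  have h: "(\<integral>\<^sup>+x. h x \<partial>lborel) = ennreal (0 - (- c * exp (- 0 / c)))"
    unfolding h_def
  proof (rule nn_integral_FTC_atLeast)
    show "((\<lambda>x. - c * exp (- x / c)) \<longlongrightarrow> 0) at_top"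
      using c by real_asymp
  qed (use c in \<open>auto intro!: derivative_eq_intros\<close>)
  have m [measurable]: "h \<in> borel_measurable borel" unfolding h_def by measurable
  have "(\<integral>\<^sup>+x. ennreal (rho l x) \<partial>lborel) \<le> (\<integral>\<^sup>+x. h x + h (- x) \<partial>lborel)"
    by (intro nn_integral_mono) (auto simp: h_def rho_def c_def split: split_indicator)
  also have "\<dots> = (\<integral>\<^sup>+x. h x \<partial>lborel) + (\<integral>\<^sup>+x. h (- x) \<partial>lborel)"
    by (rule nn_integral_add) auto
  also have "(\<integral>\<^sup>+x. h (- x) \<partial>lborel) = (\<integral>\<^sup>+x. h x \<partial>lborel)"
    using nn_integral_distr[of uminus lborel borel h] by (simp add: lborel_distr_uminus)
  also have "(\<integral>\<^sup>+x. h x \<partial>lborel) + (\<integral>\<^sup>+x. h x \<partial>lborel) = ennreal c + ennreal c" by (simp add: h)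
  also have "\<dots> = ennreal (c + c)" using c by (intro ennreal_plus[symmetric]) auto
  also have "\<dots> < \<infinity>" by simp
  finally show "(\<integral>\<^sup>+x. ennreal (rho l x) \<partial>lborel) < \<infinity>" .
qed auto

text \<open>The triangle inequality \<open>|\<xi>| \<le> |\<xi> - \<eta>| + |\<eta>|\<close> in the
  exponent: one factor \<open>rho l (\<xi> - \<eta>)\<close> trades one of the two factors
  \<open>rho l \<eta>\<close> for \<open>rho l \<xi>\<close>, and an integrable
  \<open>rho l \<eta>\<close> is left.\<close>

lemma rho_prod_le:
  assumes l: "l > 0"
  shows "(rho l (\<xi> - \<eta>))\<^sup>2 * (rho l \<eta>)\<^sup>2 \<le> rho l (\<xi> - \<eta>) * (rho l \<xi> * rho l \<eta>)"
    "rho l (\<xi> - \<eta>) * (rho l \<eta>)\<^sup>2 \<le> rho l \<xi> * rho l \<eta>"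
proof -
  have 1: "rho l (\<xi> - \<eta>) * (rho l \<eta>)\<^sup>2 \<le> rho l \<xi> * rho l \<eta>"
  proof -
    have "(- \<bar>\<xi> - \<eta>\<bar> + (- \<bar>\<eta>\<bar> + - \<bar>\<eta>\<bar>)) / (8 * l) \<le> (- \<bar>\<xi>\<bar> + - \<bar>\<eta>\<bar>) / (8 * l)"
      using l by (intro divide_right_mono) auto
    then show ?thesis
      unfolding rho_def power2_eq_square exp_add[symmetric] add_divide_distrib by simp
  qed
  then show "rho l (\<xi> - \<eta>) * (rho l \<eta>)\<^sup>2 \<le> rho l \<xi> * rho l \<eta>" .
  then have "rho l (\<xi> - \<eta>) * (rho l (\<xi> - \<eta>) * (rho l \<eta>)\<^sup>2) \<le> rho l (\<xi> - \<eta>) * (rho l \<xi> * rho l \<eta>)"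
    by (rule mult_left_mono) simp
  then show "(rho l (\<xi> - \<eta>))\<^sup>2 * (rho l \<eta>)\<^sup>2 \<le> rho l (\<xi> - \<eta>) * (rho l \<xi> * rho l \<eta>)"
    by (simp add: power2_eq_square mult_ac)
qed

lemma rho_prod_le':
  assumes l: "l > 0"
  shows "(rho l (\<xi> - \<eta>))\<^sup>2 * (rho l \<eta>)\<^sup>2 \<le> rho l \<xi> * rho l \<eta>"
proof -
  have "rho l (\<xi> - \<eta>) * (rho l \<xi> * rho l \<eta>) \<le> 1 * (rho l \<xi> * rho l \<eta>)"
    by (intro mult_right_mono rho_le_1 l) auto
  with rho_prod_le(1)[OF l, of \<xi> \<eta>] show ?thesis by linarith
qed

text \<open>Mean value estimate for the exponential that keeps the common bound \<open>e\<close>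
  instead of 1, so that differences of kernels inherit the decay of the kernels.\<close>

lemma abs_exp_minus_diff_le:
  fixes p q e :: real
  assumes "exp (- p) \<le> e" "exp (- q) \<le> e"
  shows "\<bar>exp (- p) - exp (- q)\<bar> \<le> \<bar>p - q\<bar> * e"
proof -
  have *: "exp (- a) - exp (- b) \<le> (b - a) * exp (- a)" for a b :: real
  proof -
    have "1 - exp (a - b) \<le> b - a"
      using exp_ge_add_one_self[of "a - b"] by linarith
    then have "(1 - exp (a - b)) * exp (- a) \<le> (b - a) * exp (- a)"
      by (intro mult_right_mono) auto
    moreover have "exp (a - b) * exp (- a) = exp (- b)"
      by (simp flip: exp_add)
    ultimately show ?thesis by (simp add: algebra_simps)
  qed
  have "(q - p) * exp (- p) \<le> \<bar>p - q\<bar> * e" "(p - q) * exp (- q) \<le> \<bar>p - q\<bar> * e"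
    using assms by (auto intro!: mult_mono)
  with *[of p q] *[of q p] show ?thesis by (simp add: abs_le_iff)
qed

subsection \<open>The Lagrangian system and its fixed point\<close>

text \<open>Time is reversed: \<open>s = 0\<close> is the final time of the solution. The unknown \<open>b\<close> is \<open>B\<close>, from which
  \<open>accum b\<close> is \<open>A\<close>, \<open>pos b\<close> is \<open>Y\<close> and \<open>press b s x\<close> is the pressure at the point \<open>x\<close>, so that
  \<open>P s \<xi> = press b s (pos b s \<xi>)\<close>. Clamping \<open>s\<close> to \<open>{0..T}\<close> makes all of them continuous on the
  whole plane, with bounds uniform in time.\<close>

locale rB_data =
  fixes l M T :: real and A0 B0 :: "real \<Rightarrow> real"
  assumes l: "l > 0" and M: "M \<ge> 1" and T: "T > 0" "T * M \<le> 1 / 2"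
    and A0_cont: "continuous_on UNIV A0" and A0_even: "\<And>\<xi>. A0 (- \<xi>) = A0 \<xi>"
    and A0_bounds: "\<And>\<xi>. 0 \<le> A0 \<xi>" "\<And>\<xi>. A0 \<xi> \<le> 1" and A0_outer: "\<And>\<xi>. \<bar>\<xi>\<bar> \<ge> 1 \<Longrightarrow> A0 \<xi> = 1"
    and B0_cont: "continuous_on UNIV B0" and B0_even: "\<And>\<xi>. B0 (- \<xi>) = B0 \<xi>"
    and B0_bound: "\<And>\<xi>. \<bar>B0 \<xi>\<bar> \<le> (M - 1) * rho l \<xi>"
begin

definition clamp :: "real \<Rightarrow> real" where "clamp s = max 0 (min s T)"

definition accum :: "(real \<Rightarrow> real \<Rightarrow> real) \<Rightarrow> real \<Rightarrow> real \<Rightarrow> real" where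
  "accum b s \<xi> = A0 \<xi> + prim (\<lambda>r. b r \<xi>) (clamp s)"

definition pos :: "(real \<Rightarrow> real \<Rightarrow> real) \<Rightarrow> real \<Rightarrow> real \<Rightarrow> real" where
  "pos b s = prim (\<lambda>\<eta>. (accum b s \<eta>)\<^sup>2)"

definition kern :: "(real \<Rightarrow> real \<Rightarrow> real) \<Rightarrow> real \<Rightarrow> real \<Rightarrow> real \<Rightarrow> real" where
  "kern b s x \<eta> = exp (- (\<bar>x - pos b s \<eta>\<bar> / l)) * (b s \<eta>)\<^sup>2 / l"

definition press :: "(real \<Rightarrow> real \<Rightarrow> real) \<Rightarrow> real \<Rightarrow> real \<Rightarrow> real" where
  "press b s x = (\<integral>\<eta>. kern b s x \<eta> \<partial>lborel)"

text \<open>Integral form of \<open>B' = - (P / 2) A\<close> with value \<open>B0\<close> at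
  \<open>s = 0\<close>. As \<open>s\<close> occurs only through \<open>clamp s\<close>, a fixed
  point is constant in time outside \<open>{0..T}\<close>.\<close>

definition Phi :: "(real \<Rightarrow> real \<Rightarrow> real) \<Rightarrow> real \<Rightarrow> real \<Rightarrow> real" where
  "Phi b s \<xi> = B0 \<xi> - prim (\<lambda>r. press b r (pos b r \<xi>) * accum b r \<xi>) (clamp s) / 2"

definition adm :: "(real \<Rightarrow> real \<Rightarrow> real) \<Rightarrow> bool" where
  "adm b \<longleftrightarrow> continuous_on UNIV (\<lambda>(s, \<xi>). b s \<xi>) \<and> (\<forall>s \<xi>. \<bar>b s \<xi>\<bar> \<le> M * rho l \<xi>)"

definition mass :: real where "mass = (\<integral>\<eta>. rho l \<eta> \<partial>lborel)"

text \<open>\<open>C1\<close> bounds the pressure along the flow in the weighted norm and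
  \<open>C2\<close> is its Lipschitz constant there. In \<open>C2\<close>, 24 is 3 (from
  \<open>pos_Lipschitz\<close>) times 8 (from the rate of \<open>rho\<close>), and
  \<open>2 * M\<close> comes from the difference of squares of the unknowns. \<open>C3\<close> is
  the product rule for pressure times \<open>accum\<close>, the latter bounded by 2. None of them
  involves \<open>T\<close>, which can thus be chosen last.\<close>

definition C1 :: real where "C1 = exp (2 / l) * M\<^sup>2 / l * mass"
definition C2 :: real where "C2 = exp (2 / l) * (24 * M\<^sup>2 + 2 * M) / l * mass"
definition C3 :: real where "C3 = 2 * C2 + C1"

lemma mass_nonneg: "mass \<ge> 0"
  by (simp add: mass_def)

lemma C_nonneg: "C1 \<ge> 0" "C2 \<ge> 0" "C3 \<ge> 0"
  using l M mass_nonneg by (auto simp: C1_def C2_def C3_def)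

lemma clamp_bounds: "0 \<le> clamp s" "clamp s \<le> T" "\<bar>clamp s\<bar> \<le> T"
  using T by (auto simp: clamp_def)

lemma clamp_id [simp]: "0 \<le> s \<Longrightarrow> s \<le> T \<Longrightarrow> clamp s = s"
  by (auto simp: clamp_def)

lemma clamp_idem [simp]: "clamp (clamp s) = clamp s"
  by (intro clamp_id clamp_bounds)

lemma continuous_on_clamp [continuous_intros]: "continuous_on S f \<Longrightarrow> continuous_on S (\<lambda>x. clamp (f x))"
  by (auto simp: clamp_def intro!: continuous_intros)

lemma T_le: "T \<le> 1 / 2"
proof -
  have "T * 1 \<le> T * M" using M T by (intro mult_left_mono) auto
  then show ?thesis using T by linarith
qed

section \<open>Estimates for one admissible unknown\<close>

context
  fixes b assumes adm: "adm b"
begin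

lemma b_cont: "continuous_on UNIV (\<lambda>(s, \<xi>). b s \<xi>)" and b_bound: "\<bar>b s \<xi>\<bar> \<le> M * rho l \<xi>"
  using adm by (auto simp: adm_def)

lemma b_cont':
  "continuous_on S f \<Longrightarrow> continuous_on S g \<Longrightarrow> continuous_on S (\<lambda>x. b (f x) (g x))"
  by (rule continuous_on_Pair_compose[OF b_cont])

lemma b_le_M: "\<bar>b s \<xi>\<bar> \<le> M"
proof -
  have "M * rho l \<xi> \<le> M * 1" using rho_le_1[OF l] M by (intro mult_left_mono) auto
  with b_bound[of s \<xi>] show ?thesis by simp
qed

lemma b_sq_le: "(b s \<xi>)\<^sup>2 \<le> M\<^sup>2 * (rho l \<xi>)\<^sup>2"
proof -
  have "\<bar>b s \<xi>\<bar>\<^sup>2 \<le> (M * rho l \<xi>)\<^sup>2" using b_bound by (rule power_mono) simp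
  then show ?thesis by (simp add: power_mult_distrib)
qed

lemma b_sq_le': "(b s \<xi>)\<^sup>2 \<le> M\<^sup>2 * rho l \<xi>"
proof -
  have "rho l \<xi> * rho l \<xi> \<le> rho l \<xi> * 1" using rho_le_1[OF l] by (intro mult_left_mono) auto
  then have "M\<^sup>2 * (rho l \<xi>)\<^sup>2 \<le> M\<^sup>2 * rho l \<xi>" by (intro mult_left_mono) (auto simp: power2_eq_square)
  with b_sq_le[of s \<xi>] show ?thesis by linarith
qed

lemma accum_cont: "continuous_on UNIV (\<lambda>(s, \<xi>). accum b s \<xi>)"
proof -
  have *: "continuous_on UNIV (\<lambda>(\<xi>, s). prim (\<lambda>r. b r \<xi>) s)"
    by (intro continuous_on_prim_param) (auto simp: split_beta intro!: continuous_intros b_cont')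
  then show ?thesis
    unfolding accum_def split_beta
    by (intro continuous_intros b_cont' continuous_on_Pair_compose[OF *]
        continuous_on_compose2[OF A0_cont]) auto
qed

lemma accum_cont':
  "continuous_on S f \<Longrightarrow> continuous_on S g \<Longrightarrow> continuous_on S (\<lambda>x. accum b (f x) (g x))"
  by (rule continuous_on_Pair_compose[OF accum_cont])

text \<open>Here \<open>T * M \<le> 1 / 2\<close> is used: the rate of change of
  \<open>accum\<close> is at most \<open>M\<close>. Hence the Jacobian stays away from 0 outside
  \<open>{-1..1}\<close>, the basis of \<open>pos_expand\<close>.\<close>

lemma accum_near: "\<bar>accum b s \<xi> - A0 \<xi>\<bar> \<le> 1 / 2"
proof -
  have "\<bar>prim (\<lambda>r. b r \<xi>) (clamp s)\<bar> \<le> M * \<bar>clamp s\<bar>"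
    by (rule abs_prim_le) (auto intro!: continuous_intros b_cont' accum_cont' b_le_M)
  also have "\<dots> \<le> M * T" using M clamp_bounds by (intro mult_left_mono) auto
  finally show ?thesis using T by (simp add: accum_def mult.commute)
qed

lemma accum_bound: "\<bar>accum b s \<xi>\<bar> \<le> 3 / 2"
  using accum_near[of s \<xi>] A0_bounds[of \<xi>] by linarith

lemma accum_outer: "\<bar>\<xi>\<bar> \<ge> 1 \<Longrightarrow> accum b s \<xi> \<ge> 1 / 2"
  using accum_near[of s \<xi>] A0_outer[of \<xi>] by linarith

lemma pos_deriv: "(pos b s has_real_derivative (accum b s \<xi>)\<^sup>2) (at \<xi>)"
  unfolding pos_def by (rule has_real_derivative_prim) (intro continuous_intros b_cont' accum_cont')

lemma pos_cont: "continuous_on UNIV (\<lambda>(s, \<xi>). pos b s \<xi>)"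
  unfolding pos_def
  by (rule continuous_on_prim_param) (auto simp: split_beta intro!: continuous_intros b_cont' accum_cont')

lemma pos_cont':
  "continuous_on S f \<Longrightarrow> continuous_on S g \<Longrightarrow> continuous_on S (\<lambda>x. pos b (f x) (g x))"
  by (rule continuous_on_Pair_compose[OF pos_cont])

lemma pos_mono: "\<eta> \<le> \<xi> \<Longrightarrow> pos b s \<eta> \<le> pos b s \<xi>"
  by (rule DERIV_nonneg_imp_nondecreasing[of \<eta> \<xi> "pos b s"]) (use pos_deriv zero_le_power2 in blast)+

text \<open>The derivative of \<open>pos b s\<close> may be small on \<open>{-1..1}\<close> only; there \<open>arctan\<close>, which is
  bounded, makes up for it.\<close>

lemma pos_expand: "\<bar>pos b s \<xi> - pos b s \<eta>\<bar> \<ge> \<bar>\<xi> - \<eta>\<bar> / 4 - 2"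
proof -
  have *: "pos b s \<xi> - pos b s \<eta> \<ge> (\<xi> - \<eta>) / 4 - 2" if "\<eta> \<le> \<xi>" for \<xi> \<eta>
  proof -
    define f where "f = (\<lambda>x. pos b s x - x / 4 + arctan x / 2)"
    have "f \<eta> \<le> f \<xi>"
    proof (rule DERIV_nonneg_imp_nondecreasing[OF that], intro exI conjI)
      fix x
      show "(f has_real_derivative (accum b s x)\<^sup>2 - 1 / 4 + inverse (1 + x\<^sup>2) / 2) (at x)"
        unfolding f_def by (auto intro!: derivative_eq_intros pos_deriv)
      show "(accum b s x)\<^sup>2 - 1 / 4 + inverse (1 + x\<^sup>2) / 2 \<ge> 0"
      proof (cases "\<bar>x\<bar> \<ge> 1")
        case True
        then have "(1 / 2)\<^sup>2 \<le> (accum b s x)\<^sup>2" by (intro power_mono accum_outer) auto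
        moreover have "inverse (1 + x\<^sup>2) \<ge> 0" by simp
        ultimately show ?thesis unfolding power2_eq_square by linarith
      next
        case False
        then have "x\<^sup>2 \<le> 1" by (simp add: abs_square_le_1)
        then have "inverse (1 + x\<^sup>2) \<ge> 1 / 2"
          by (simp add: field_simps add_pos_nonneg)
        then show ?thesis using zero_le_power2[of "accum b s x"] by linarith
      qed
    qed
    moreover have "arctan \<xi> < pi / 2" "arctan \<eta> > - pi / 2"
      using arctan_bounded by auto
    ultimately show ?thesis using pi_less_4 by (simp add: f_def field_simps)
  qed
  show ?thesis
  proof (cases "\<eta> \<le> \<xi>")
    case True
    then show ?thesis using *[OF True] by linarith
  next
    case False
    then have "\<xi> \<le> \<eta>" by simp
    moreover from this have "\<bar>\<xi> - \<eta>\<bar> = \<eta> - \<xi>" by simp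
    ultimately show ?thesis
      using *[of \<xi> \<eta>] abs_ge_minus_self[of "pos b s \<xi> - pos b s \<eta>"] by simp
  qed
qed

lemma exp_pos_le:
  "exp (- (\<bar>pos b s \<xi> - pos b s \<eta>\<bar> / l)) \<le> exp (2 / l) * (rho l (\<xi> - \<eta>))\<^sup>2"
proof -
  have "- (\<bar>pos b s \<xi> - pos b s \<eta>\<bar> / l) \<le> - ((\<bar>\<xi> - \<eta>\<bar> / 4 - 2) / l)"
    using pos_expand[of \<xi> \<eta> s] l by (simp add: divide_right_mono)
  also have "\<dots> = 2 / l + 2 * (- \<bar>\<xi> - \<eta>\<bar> / (8 * l))"
    using l by (simp add: field_simps)
  finally show ?thesis
    unfolding rho_def power2_eq_square by (simp flip: exp_add)
qed

lemma kern_nonneg: "kern b s x \<eta> \<ge> 0"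
  using l by (simp add: kern_def)

lemma kern_cont:
  "continuous_on S f \<Longrightarrow> continuous_on S g \<Longrightarrow> continuous_on S h \<Longrightarrow> continuous_on S (\<lambda>z. kern b (f z) (g z) (h z))"
  using l unfolding kern_def by (intro continuous_intros b_cont' accum_cont' pos_cont') auto

lemma kern_measurable [measurable]: "kern b s x \<in> borel_measurable borel"
  by (intro borel_measurable_continuous_onI kern_cont continuous_intros b_cont' accum_cont' pos_cont')

lemma kern_bound: "kern b s x \<eta> \<le> M\<^sup>2 / l * rho l \<eta>"
proof -
  have "exp (- (\<bar>x - pos b s \<eta>\<bar> / l)) * (b s \<eta>)\<^sup>2 \<le> 1 * (M\<^sup>2 * rho l \<eta>)"
    using l by (intro mult_mono b_sq_le') auto
  then show ?thesis using l by (simp add: kern_def field_simps)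
qed

lemma kern_integrable: "integrable lborel (kern b s x)"
  by (rule Bochner_Integration.integrable_bound[OF integrable_mult_right[OF integrable_rho[OF l], of "M\<^sup>2 / l"]])
    (use kern_bound kern_nonneg l in \<open>auto simp: abs_mult\<close>)

lemma press_nonneg: "press b s x \<ge> 0"
  by (simp add: press_def kern_nonneg)

text \<open>Dominated convergence; the majorant from \<open>kern_bound\<close> depends neither on
  \<open>s\<close> nor on \<open>x\<close>.\<close>

lemma press_cont: "continuous_on UNIV (\<lambda>(s, x). press b s x)"
  unfolding continuous_on_sequentially
proof (intro allI ballI impI, elim conjE)
  fix z :: "nat \<Rightarrow> real \<times> real" and a
  assume z: "z \<longlonglongrightarrow> a"
  have "(\<lambda>n. \<integral>\<eta>. kern b (fst (z n)) (snd (z n)) \<eta> \<partial>lborel) \<longlonglongrightarrow> (\<integral>\<eta>. kern b (fst a) (snd a) \<eta> \<partial>lborel)"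
  proof (rule integral_dominated_convergence)
    show "integrable lborel (\<lambda>\<eta>. M\<^sup>2 / l * rho l \<eta>)"
      by (intro integrable_mult_right integrable_rho l)
    show "AE \<eta> in lborel. (\<lambda>n. kern b (fst (z n)) (snd (z n)) \<eta>) \<longlonglongrightarrow> kern b (fst a) (snd a) \<eta>"
    proof (rule AE_I2)
      fix \<eta>
      have "continuous_on UNIV (\<lambda>z. kern b (fst z) (snd z) \<eta>)"
        by (intro kern_cont continuous_intros b_cont' accum_cont' pos_cont')
      then show "(\<lambda>n. kern b (fst (z n)) (snd (z n)) \<eta>) \<longlonglongrightarrow> kern b (fst a) (snd a) \<eta>"
        by (rule continuous_on_tendsto_compose[OF _ z]) auto
    qed
  qed (use kern_nonneg kern_bound in auto)
  then show "((\<lambda>(s, x). press b s x) \<circ> z) \<longlonglongrightarrow> (case a of (s, x) \<Rightarrow> press b s x)"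
    by (simp add: press_def split_beta o_def)
qed

lemma press_cont':
  "continuous_on S f \<Longrightarrow> continuous_on S g \<Longrightarrow> continuous_on S (\<lambda>x. press b (f x) (g x))"
  by (rule continuous_on_Pair_compose[OF press_cont])

text \<open>In contrast to \<open>kern_bound\<close>, the evaluation at a point of the flow yields
  decay in \<xi> too. This lets \<open>Phi\<close> preserve the weighted bound.\<close>

lemma kern_pos_bound: "kern b s (pos b s \<xi>) \<eta> \<le> exp (2 / l) * M\<^sup>2 / l * rho l \<xi> * rho l \<eta>"
proof -
  have "exp (- (\<bar>pos b s \<xi> - pos b s \<eta>\<bar> / l)) * (b s \<eta>)\<^sup>2
      \<le> (exp (2 / l) * (rho l (\<xi> - \<eta>))\<^sup>2) * (M\<^sup>2 * (rho l \<eta>)\<^sup>2)"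
    by (intro mult_mono exp_pos_le b_sq_le) auto
  also have "\<dots> = exp (2 / l) * M\<^sup>2 * ((rho l (\<xi> - \<eta>))\<^sup>2 * (rho l \<eta>)\<^sup>2)" by (simp add: mult_ac)
  also have "\<dots> \<le> exp (2 / l) * M\<^sup>2 * (rho l \<xi> * rho l \<eta>)"
    by (intro mult_left_mono rho_prod_le' l) auto
  finally show ?thesis using l by (simp add: kern_def divide_right_mono mult_ac)
qed

lemma press_pos_bound: "press b s (pos b s \<xi>) \<le> C1 * rho l \<xi>"
proof -
  have "press b s (pos b s \<xi>) \<le> (\<integral>\<eta>. exp (2 / l) * M\<^sup>2 / l * rho l \<xi> * rho l \<eta> \<partial>lborel)"
    unfolding press_def
    by (intro integral_mono kern_integrable kern_pos_bound integrable_mult_right integrable_rho l)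
  then show ?thesis by (simp add: mass_def C1_def mult_ac)
qed

lemma Phi_cont: "continuous_on UNIV (\<lambda>(s, \<xi>). Phi b s \<xi>)"
proof -
  have *: "continuous_on UNIV (\<lambda>(\<xi>, s). prim (\<lambda>r. press b r (pos b r \<xi>) * accum b r \<xi>) s)"
    by (intro continuous_on_prim_param) (auto simp: split_beta intro!: continuous_intros b_cont' accum_cont' pos_cont' press_cont')
  then show ?thesis
    unfolding Phi_def split_beta
    by (intro continuous_intros b_cont' accum_cont' pos_cont' press_cont' continuous_on_compose2[OF B0_cont]
       continuous_on_Pair_compose[OF *]) auto
qed

lemma Phi_near: 
  assumes "T * C1 \<le> 1 / 2"
  shows "\<bar>Phi b s \<xi> - B0 \<xi>\<bar> \<le> 1 / 2 * rho l \<xi>"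
proof -
  have "\<bar>prim (\<lambda>r. press b r (pos b r \<xi>) * accum b r \<xi>) (clamp s)\<bar> \<le> ((C1 * rho l \<xi>) * 2) * \<bar>clamp s\<bar>"
  proof (rule abs_prim_le)
    fix r
    show "\<bar>press b r (pos b r \<xi>) * accum b r \<xi>\<bar> \<le> (C1 * rho l \<xi>) * 2"
      unfolding abs_mult using press_pos_bound[of r \<xi>] press_nonneg[of r] accum_bound[of r \<xi>] C_nonneg
      by (intro mult_mono) auto
  qed (intro continuous_intros b_cont' accum_cont' pos_cont' press_cont')
  also have "\<dots> \<le> ((C1 * rho l \<xi>) * 2) * T"
    using C_nonneg clamp_bounds by (intro mult_left_mono) auto
  also have "\<dots> = 2 * (T * C1) * rho l \<xi>" by (simp add: mult_ac)
  also have "\<dots> \<le> 2 * (1 / 2) * rho l \<xi>" using assms by (intro mult_right_mono mult_left_mono) auto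
  finally show ?thesis by (simp add: Phi_def)
qed

text \<open>The bound on \<open>B0\<close> is \<open>M - 1\<close> rather than \<open>M\<close> to
  leave room for the integral term, which contributes at most half of
  \<open>rho l \<xi>\<close>.\<close>

lemma adm_Phi:
  assumes "T * C1 \<le> 1 / 2"
  shows "adm (Phi b)"
  unfolding adm_def
proof (intro conjI allI Phi_cont)
  fix s \<xi>
  have "(M - 1) * rho l \<xi> + 1 / 2 * rho l \<xi> \<le> M * rho l \<xi>"
    by (simp add: algebra_simps)
  with Phi_near[OF assms, of s \<xi>] B0_bound[of \<xi>] show "\<bar>Phi b s \<xi>\<bar> \<le> M * rho l \<xi>"
    by linarith
qed

context
  assumes even: "\<And>s \<xi>. b s (- \<xi>) = b s \<xi>"
begin

lemma accum_even: "accum b s (- \<xi>) = accum b s \<xi>"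
  by (simp add: accum_def even A0_even)

lemma pos_odd: "pos b s (- \<xi>) = - pos b s \<xi>"
proof -
  have "continuous_on UNIV (\<lambda>\<eta>. (accum b s \<eta>)\<^sup>2)"
    by (intro continuous_intros accum_cont')
  from prim_uminus[OF this, of \<xi>] show ?thesis
    by (simp add: pos_def accum_even)
qed

lemma press_even: "press b s (- x) = press b s x"
proof -
  have "press b s x = (\<integral>\<eta>. kern b s x \<eta> \<partial>distr lborel borel uminus)"
    by (simp add: press_def lborel_distr_uminus)
  also have "\<dots> = (\<integral>\<eta>. kern b s x (- \<eta>) \<partial>lborel)"
    by (subst integral_distr) auto
  also have "(\<lambda>\<eta>. kern b s x (- \<eta>)) = kern b s (- x)"
    using abs_minus_cancel[of "x + pos b s _"]
    by (auto simp: fun_eq_iff kern_def pos_odd even simp del: abs_minus_cancel)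
  finally show ?thesis by (simp add: press_def)
qed

text \<open>\<open>pos\<close> is normalised to vanish at 0, which describes the flow only if the
  velocity vanishes there. Oddness of the velocity guarantees this, so evenness of the unknown has
  to survive the iteration.\<close>

lemma Phi_even: "Phi b s (- \<xi>) = Phi b s \<xi>"
  by (simp add: Phi_def accum_even pos_odd press_even B0_even)

end

end

section \<open>Contraction estimate and fixed point\<close>

context
  fixes b b' d
  assumes adm: "adm b" "adm b'" and d: "d \<ge> 0" "\<And>s \<xi>. \<bar>b s \<xi> - b' s \<xi>\<bar> \<le> d * rho l \<xi>"
begin

lemma accum_Lipschitz: "\<bar>accum b s \<xi> - accum b' s \<xi>\<bar> \<le> d"
proof -
  have d': "\<bar>b s \<xi> - b' s \<xi>\<bar> \<le> d" for s \<xi>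
    using d(2)[of s \<xi>] mult_left_mono[OF rho_le_1[OF l, of \<xi>] d(1)] by simp
  have "accum b s \<xi> - accum b' s \<xi> = prim (\<lambda>r. b r \<xi> - b' r \<xi>) (clamp s)"
    by (subst prim_diff) (auto simp: accum_def intro!: continuous_intros b_cont'[OF adm(1)] b_cont'[OF adm(2)])
  also have "\<bar>\<dots>\<bar> \<le> d * \<bar>clamp s\<bar>"
    by (rule abs_prim_le) (auto intro!: continuous_intros d' b_cont'[OF adm(1)] b_cont'[OF adm(2)])
  also have "\<dots> \<le> d * 1" using T_le clamp_bounds[of s] d by (intro mult_left_mono) linarith+
  finally show ?thesis by simp
qed

text \<open>The kernel sees \<open>pos\<close> only through increments, so these are compared. The
  derivative of the difference is a difference of squares, bounded by
  \<open>|A + A'| |A - A'|\<close> with \<open>|A + A'| \<le> 3\<close>. The resulting growth in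
  \<open>|\<xi> - \<eta>|\<close> is harmless against the decay of the kernel.\<close>

lemma pos_Lipschitz:
  "\<bar>(pos b s \<xi> - pos b s \<eta>) - (pos b' s \<xi> - pos b' s \<eta>)\<bar> \<le> 3 * d * \<bar>\<xi> - \<eta>\<bar>"
proof -
  have "\<bar>(pos b s \<xi> - pos b' s \<xi>) - (pos b s \<eta> - pos b' s \<eta>)\<bar> \<le> 3 * d * \<bar>\<xi> - \<eta>\<bar>"
  proof (rule DERIV_bound_diff)
    fix x
    show "((\<lambda>x. pos b s x - pos b' s x) has_real_derivative (accum b s x)\<^sup>2 - (accum b' s x)\<^sup>2) (at x)"
      by (intro derivative_intros pos_deriv adm)
    have "\<bar>(accum b s x)\<^sup>2 - (accum b' s x)\<^sup>2\<bar> = \<bar>accum b s x + accum b' s x\<bar> * \<bar>accum b s x - accum b' s x\<bar>"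
      by (simp add: abs_mult[symmetric] power2_eq_square algebra_simps)
    also have "\<dots> \<le> 3 * d"
      using accum_bound[OF adm(1), of s x] accum_bound[OF adm(2), of s x] d
      by (intro mult_mono accum_Lipschitz) auto
    finally show "\<bar>(accum b s x)\<^sup>2 - (accum b' s x)\<^sup>2\<bar> \<le> 3 * d" .
  qed
  then show ?thesis by (simp add: algebra_simps)
qed

lemma kern_Lipschitz:
  "\<bar>kern b s (pos b s \<xi>) \<eta> - kern b' s (pos b' s \<xi>) \<eta>\<bar>
     \<le> exp (2 / l) * (24 * M\<^sup>2 + 2 * M) / l * d * rho l \<xi> * rho l \<eta>"
proof -
  define p q where "p = \<bar>pos b s \<xi> - pos b s \<eta>\<bar> / l" and "q = \<bar>pos b' s \<xi> - pos b' s \<eta>\<bar> / l"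
  define E r where "E = exp (2 / l)" and "r = rho l (\<xi> - \<eta>)"
  have pq: "exp (- p) \<le> E * r\<^sup>2" "exp (- q) \<le> E * r\<^sup>2"
    unfolding p_def q_def E_def r_def by (intro exp_pos_le adm)+
  have Er: "E \<ge> 0" "r \<ge> 0" by (auto simp: E_def r_def)
  have "\<bar>p - q\<bar> = \<bar>\<bar>pos b s \<xi> - pos b s \<eta>\<bar> - \<bar>pos b' s \<xi> - pos b' s \<eta>\<bar>\<bar> / l"
    using l by (simp add: p_def q_def diff_divide_distrib[symmetric])
  also have "\<dots> \<le> (3 * d * \<bar>\<xi> - \<eta>\<bar>) / l"
    using pos_Lipschitz[of s \<xi> \<eta>] l by (intro divide_right_mono) linarith+
  finally have pq': "\<bar>p - q\<bar> \<le> 3 * d * \<bar>\<xi> - \<eta>\<bar> / l" .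
  \<comment> \<open>By \<open>y * exp (- y) \<le> 1\<close>: one of the two factors \<open>r\<close>
    in the kernel bound pays for the linear factor from \<open>pos_Lipschitz\<close>; the other
    remains for \<open>rho_prod_le\<close>.\<close>
  have r: "\<bar>\<xi> - \<eta>\<bar> * r \<le> 8 * l"
  proof -
    define y where "y = \<bar>\<xi> - \<eta>\<bar> / (8 * l)"
    have "y * exp (- y) \<le> exp y * exp (- y)"
      using exp_ge_add_one_self[of y] by (intro mult_right_mono) (linarith, simp)
    then have "y * r \<le> 1" by (simp add: r_def rho_def y_def flip: exp_add)
    then show ?thesis using l by (simp add: y_def field_simps)
  qed
  have 1: "\<bar>exp (- p) - exp (- q)\<bar> * (b s \<eta>)\<^sup>2 \<le> E * 24 * M\<^sup>2 * d * (rho l \<xi> * rho l \<eta>)"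
  proof -
    have "\<bar>exp (- p) - exp (- q)\<bar> \<le> \<bar>p - q\<bar> * (E * r\<^sup>2)"
      using pq by (rule abs_exp_minus_diff_le)
    also have "\<dots> \<le> (3 * d * \<bar>\<xi> - \<eta>\<bar> / l) * (E * r\<^sup>2)"
      using pq' Er by (intro mult_right_mono) auto
    also have "\<dots> = (3 * d * E * r / l) * (\<bar>\<xi> - \<eta>\<bar> * r)"
      by (simp add: power2_eq_square)
    also have "\<dots> \<le> (3 * d * E * r / l) * (8 * l)"
      using r Er d l by (intro mult_left_mono) auto
    also have "\<dots> = 24 * d * E * r" using l by simp
    finally have "\<bar>exp (- p) - exp (- q)\<bar> * (b s \<eta>)\<^sup>2 \<le> (24 * d * E * r) * (M\<^sup>2 * (rho l \<eta>)\<^sup>2)"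
      using Er d by (intro mult_mono b_sq_le adm) auto
    also have "\<dots> = E * 24 * M\<^sup>2 * d * (r * (rho l \<eta>)\<^sup>2)" by (simp add: mult_ac)
    also have "\<dots> \<le> E * 24 * M\<^sup>2 * d * (rho l \<xi> * rho l \<eta>)"
      unfolding r_def using Er d by (intro mult_left_mono rho_prod_le[OF l]) auto
    finally show ?thesis .
  qed
  have 2: "exp (- q) * \<bar>(b s \<eta>)\<^sup>2 - (b' s \<eta>)\<^sup>2\<bar> \<le> E * 2 * M * d * (rho l \<xi> * rho l \<eta>)"
  proof -
    have "\<bar>(b s \<eta>)\<^sup>2 - (b' s \<eta>)\<^sup>2\<bar> = \<bar>b s \<eta> + b' s \<eta>\<bar> * \<bar>b s \<eta> - b' s \<eta>\<bar>"
      by (simp add: abs_mult[symmetric] power2_eq_square algebra_simps)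
    also have "\<dots> \<le> (2 * M * rho l \<eta>) * (d * rho l \<eta>)"
      using b_bound[OF adm(1), of s \<eta>] b_bound[OF adm(2), of s \<eta>] d M by (intro mult_mono) auto
    finally have "exp (- q) * \<bar>(b s \<eta>)\<^sup>2 - (b' s \<eta>)\<^sup>2\<bar> \<le> (E * r\<^sup>2) * ((2 * M * rho l \<eta>) * (d * rho l \<eta>))"
      using pq Er by (intro mult_mono) auto
    also have "\<dots> = E * 2 * M * d * (r\<^sup>2 * (rho l \<eta>)\<^sup>2)" by (simp add: mult_ac power2_eq_square)
    also have "\<dots> \<le> E * 2 * M * d * (rho l \<xi> * rho l \<eta>)"
      unfolding r_def using Er d M by (intro mult_left_mono rho_prod_le'[OF l]) auto
    finally show ?thesis .
  qed
  have "kern b s (pos b s \<xi>) \<eta> - kern b' s (pos b' s \<xi>) \<eta>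
     = ((exp (- p) - exp (- q)) * (b s \<eta>)\<^sup>2 + exp (- q) * ((b s \<eta>)\<^sup>2 - (b' s \<eta>)\<^sup>2)) / l"
    by (simp add: kern_def p_def q_def algebra_simps diff_divide_distrib)
  also have "\<bar>\<dots>\<bar> \<le> (\<bar>exp (- p) - exp (- q)\<bar> * (b s \<eta>)\<^sup>2 + exp (- q) * \<bar>(b s \<eta>)\<^sup>2 - (b' s \<eta>)\<^sup>2\<bar>) / l"
    using l abs_triangle_ineq[of "(exp (- p) - exp (- q)) * (b s \<eta>)\<^sup>2" "exp (- q) * ((b s \<eta>)\<^sup>2 - (b' s \<eta>)\<^sup>2)"]
    by (simp add: abs_mult divide_right_mono)
  also have "\<dots> \<le> (E * 24 * M\<^sup>2 * d * (rho l \<xi> * rho l \<eta>) + E * 2 * M * d * (rho l \<xi> * rho l \<eta>)) / l"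
    using l by (intro divide_right_mono add_mono 1 2) auto
  also have "\<dots> = E * (24 * M\<^sup>2 + 2 * M) / l * d * rho l \<xi> * rho l \<eta>"
    by (simp add: algebra_simps add_divide_distrib)
  finally show ?thesis by (simp add: E_def)
qed

lemma press_Lipschitz: "\<bar>press b s (pos b s \<xi>) - press b' s (pos b' s \<xi>)\<bar> \<le> C2 * d * rho l \<xi>"
proof -
  have "\<bar>press b s (pos b s \<xi>) - press b' s (pos b' s \<xi>)\<bar>
     = \<bar>\<integral>\<eta>. kern b s (pos b s \<xi>) \<eta> - kern b' s (pos b' s \<xi>) \<eta> \<partial>lborel\<bar>"
    unfolding press_def by (subst Bochner_Integration.integral_diff) (auto intro: kern_integrable adm)
  also have "\<dots> \<le> (\<integral>\<eta>. \<bar>kern b s (pos b s \<xi>) \<eta> - kern b' s (pos b' s \<xi>) \<eta>\<bar> \<partial>lborel)"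
    by (rule integral_abs_bound)
  also have "\<dots> \<le> (\<integral>\<eta>. exp (2 / l) * (24 * M\<^sup>2 + 2 * M) / l * d * rho l \<xi> * rho l \<eta> \<partial>lborel)"
    by (intro integral_mono kern_Lipschitz integrable_abs Bochner_Integration.integrable_diff
        kern_integrable adm integrable_mult_right integrable_rho l)
  finally show ?thesis by (simp add: mass_def C2_def mult_ac)
qed

lemma Phi_Lipschitz:
  assumes "T * C3 \<le> 1"
  shows "\<bar>Phi b s \<xi> - Phi b' s \<xi>\<bar> \<le> d / 2 * rho l \<xi>"
proof -
  have c: "continuous_on UNIV (\<lambda>r. press c r (pos c r \<xi>) * accum c r \<xi>)" if "adm c" for c
    by (intro continuous_intros press_cont' pos_cont' accum_cont' that)
  have "\<bar>prim (\<lambda>r. press b r (pos b r \<xi>) * accum b r \<xi> - press b' r (pos b' r \<xi>) * accum b' r \<xi>) (clamp s)\<bar>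
      \<le> (C3 * d * rho l \<xi>) * \<bar>clamp s\<bar>"
  proof (rule abs_prim_le)
    fix r
    let ?p = "press b r (pos b r \<xi>)" and ?q = "press b' r (pos b' r \<xi>)"
    have "\<bar>?p * accum b r \<xi> - ?q * accum b' r \<xi>\<bar>
       = \<bar>(?p - ?q) * accum b r \<xi> + ?q * (accum b r \<xi> - accum b' r \<xi>)\<bar>"
      by (simp add: algebra_simps)
    also have "\<dots> \<le> \<bar>?p - ?q\<bar> * \<bar>accum b r \<xi>\<bar> + ?q * \<bar>accum b r \<xi> - accum b' r \<xi>\<bar>"
      using abs_triangle_ineq press_nonneg[OF adm(2)] by (metis abs_mult abs_of_nonneg)
    also have "\<dots> \<le> (C2 * d * rho l \<xi>) * 2 + (C1 * rho l \<xi>) * d"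
      using accum_bound[OF adm(1), of r \<xi>] C_nonneg d press_nonneg[OF adm(2)]
      by (intro add_mono mult_mono press_Lipschitz press_pos_bound accum_Lipschitz adm) auto
    also have "\<dots> = C3 * d * rho l \<xi>" by (simp add: C3_def algebra_simps)
    finally show "\<bar>?p * accum b r \<xi> - ?q * accum b' r \<xi>\<bar> \<le> C3 * d * rho l \<xi>" .
  qed (intro continuous_on_diff c adm)
  also have "\<dots> \<le> (C3 * d * rho l \<xi>) * T"
    using clamp_bounds C_nonneg d by (intro mult_left_mono) auto
  also have "\<dots> = (T * C3) * (d * rho l \<xi>)" by (simp add: mult_ac)
  also have "\<dots> \<le> 1 * (d * rho l \<xi>)" using assms d by (intro mult_right_mono) auto
  finally show ?thesis
    unfolding prim_diff[OF c[OF adm(1)] c[OF adm(2)]] Phi_def by linarith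
qed

end

text \<open>Dividing by \<open>rho l\<close> turns the weighted norm into the supremum norm, so the
  Banach fixed point theorem applies to the even bounded continuous functions of norm at most
  \<open>M\<close>, a closed subset of a complete space. \<open>Phi_Lipschitz\<close> gives the
  factor 1/2.\<close>

lemma fixed_point_exists:
  assumes "T * C1 \<le> 1 / 2" "T * C3 \<le> 1"
  obtains b where "adm b" "\<And>s \<xi>. b s (- \<xi>) = b s \<xi>" "\<And>s \<xi>. b s \<xi> = Phi b s \<xi>"
proof -
  define S where "S = {\<beta> :: (real \<times> real) \<Rightarrow>\<^sub>C real. (\<forall>p. \<bar>\<beta> p\<bar> \<le> M) \<and> (\<forall>s \<xi>. \<beta> (s, - \<xi>) = \<beta> (s, \<xi>))}"
  define lift where "lift = (\<lambda>(\<beta> :: (real \<times> real) \<Rightarrow>\<^sub>C real) s \<xi>. rho l \<xi> * \<beta> (s, \<xi>))"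
  \<comment> \<open>\<open>Bcontfun\<close> has the intended value only where its argument is
    bounded and continuous; this is established on \<open>S\<close> by way of
    \<open>adm_Phi\<close>.\<close>
  define G where "G = (\<lambda>\<beta>. Bcontfun (\<lambda>(s, \<xi>). Phi (lift \<beta>) s \<xi> / rho l \<xi>))"
  have adm_lift: "adm (lift \<beta>)" if "\<beta> \<in> S" for \<beta>
  proof -
    have "\<bar>lift \<beta> s \<xi>\<bar> \<le> M * rho l \<xi>" for s \<xi>
      using that by (auto simp: S_def lift_def abs_mult mult.commute intro!: mult_right_mono)
    moreover have "continuous_on UNIV (\<lambda>(s, \<xi>). lift \<beta> s \<xi>)"
      unfolding lift_def split_beta by (intro continuous_intros) auto
    ultimately show ?thesis by (simp add: adm_def)
  qed
  have lift_even: "lift \<beta> s (- \<xi>) = lift \<beta> s \<xi>" if "\<beta> \<in> S" for \<beta> s \<xi>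
    using that by (simp add: S_def lift_def)
  have G_apply: "G \<beta> p = Phi (lift \<beta>) (fst p) (snd p) / rho l (snd p)"
    and G_le: "\<bar>G \<beta> p\<bar> \<le> M" if "\<beta> \<in> S" for \<beta> p
  proof -
    note a = adm_Phi[OF adm_lift[OF that] assms(1)]
    have le: "\<bar>Phi (lift \<beta>) s \<xi> / rho l \<xi>\<bar> \<le> M" for s \<xi>
      using b_bound[OF a, of s \<xi>] by (simp add: field_simps)
    have "(\<lambda>(s, \<xi>). Phi (lift \<beta>) s \<xi> / rho l \<xi>) \<in> bcontfun"
      unfolding bcontfun_def
    proof (intro CollectI conjI)
      show "continuous_on UNIV (\<lambda>(s, \<xi>). Phi (lift \<beta>) s \<xi> / rho l \<xi>)"
        unfolding split_beta by (intro continuous_intros b_cont'[OF a]) auto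
      show "bounded (range (\<lambda>(s, \<xi>). Phi (lift \<beta>) s \<xi> / rho l \<xi>))"
        unfolding bounded_iff using le by auto
    qed
    then show *: "G \<beta> p = Phi (lift \<beta>) (fst p) (snd p) / rho l (snd p)"
      by (simp add: G_def Bcontfun_inverse split_beta)
    show "\<bar>G \<beta> p\<bar> \<le> M" unfolding * by (rule le)
  qed
  have "\<exists>!\<beta>\<in>S. G \<beta> = \<beta>"
  proof (rule Banach_fix)
    have "closed S"
      unfolding closed_sequential_limits
    proof (intro allI impI, elim conjE)
      fix x and y :: "(real \<times> real) \<Rightarrow>\<^sub>C real"
      assume x: "\<forall>n. x n \<in> S" and "x \<longlonglongrightarrow> y"
      have lim: "(\<lambda>n. x n p) \<longlonglongrightarrow> y p" for p
        using tendsto_uniform_limitI[OF tendsto_bcontfun_uniform_limit[OF \<open>x \<longlonglongrightarrow> y\<close>]] by auto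
      have "\<bar>y p\<bar> \<le> M" for p
        using x by (intro LIMSEQ_le_const2[OF tendsto_rabs[OF lim]] exI[of _ 0]) (auto simp: S_def simp del: split_paired_All)
      moreover have "y (s, - \<xi>) = y (s, \<xi>)" for s \<xi>
        using LIMSEQ_unique[OF lim[of "(s, - \<xi>)"]] lim[of "(s, \<xi>)"] x by (auto simp: S_def)
      ultimately show "y \<in> S" by (simp add: S_def)
    qed
    then show "complete S" by (simp add: complete_eq_closed)
    have "const_bcontfun 0 \<in> S" using M by (auto simp: S_def const_bcontfun.rep_eq)
    then show "S \<noteq> {}" by blast
    show "G ` S \<subseteq> S"
      using G_le by (auto simp: S_def G_apply[unfolded S_def] Phi_even[OF adm_lift lift_even, unfolded S_def])
    show "dist (G \<beta>) (G \<beta>') \<le> 1 / 2 * dist \<beta> \<beta>'" if "\<beta> \<in> S" "\<beta>' \<in> S" for \<beta> \<beta>'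
    proof (rule dist_bound)
      fix p
      have "\<bar>lift \<beta> s \<xi> - lift \<beta>' s \<xi>\<bar> \<le> dist \<beta> \<beta>' * rho l \<xi>" for s \<xi>
      proof -
        have "\<bar>lift \<beta> s \<xi> - lift \<beta>' s \<xi>\<bar> = rho l \<xi> * dist (\<beta> (s, \<xi>)) (\<beta>' (s, \<xi>))"
          by (simp add: lift_def dist_real_def abs_mult flip: right_diff_distrib)
        also have "\<dots> \<le> rho l \<xi> * dist \<beta> \<beta>'" by (intro mult_left_mono dist_bounded) auto
        finally show ?thesis by (simp add: mult.commute)
      qed
      from Phi_Lipschitz[OF adm_lift[OF that(1)] adm_lift[OF that(2)] _ this assms(2), of "fst p" "snd p"]
      have "\<bar>Phi (lift \<beta>) (fst p) (snd p) - Phi (lift \<beta>') (fst p) (snd p)\<bar> \<le> dist \<beta> \<beta>' / 2 * rho l (snd p)"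
        by simp
      then show "dist (G \<beta> p) (G \<beta>' p) \<le> 1 / 2 * dist \<beta> \<beta>'"
        by (simp add: G_apply that dist_real_def field_simps flip: diff_divide_distrib)
    qed
  qed auto
  then obtain \<beta> where \<beta>: "\<beta> \<in> S" "G \<beta> = \<beta>" by blast
  show thesis
  proof
    show "adm (lift \<beta>)" by (rule adm_lift) fact
    show "lift \<beta> s (- \<xi>) = lift \<beta> s \<xi>" for s \<xi> by (rule lift_even) fact
    show "lift \<beta> s \<xi> = Phi (lift \<beta>) s \<xi>" for s \<xi>
      using G_apply[OF \<beta>(1), of "(s, \<xi>)"] \<beta>(2) by (simp add: lift_def)
  qed
qed

end

subsection \<open>The flow\<close>

text \<open>Mean value theorem with mere continuity at the endpoints, as the clamped paths need not
  be differentiable at times 0 and \<open>T\<close>.\<close>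

lemma interior_derivative_bound:
  fixes f :: "real \<Rightarrow> real"
  assumes c: "continuous_on {a..b} f"
    and d: "\<And>x. a < x \<Longrightarrow> x < b \<Longrightarrow> (f has_real_derivative f' x) (at x)"
    and le: "\<And>x. \<bar>f' x\<bar> \<le> C" and xy: "x \<in> {a..b}" "y \<in> {a..b}"
  shows "\<bar>f x - f y\<bar> \<le> C * \<bar>x - y\<bar>"
proof -
  have *: "\<bar>f y - f x\<bar> \<le> C * \<bar>y - x\<bar>" if "x < y" "x \<in> {a..b}" "y \<in> {a..b}" for x y
  proof -
    have "continuous_on {x..y} f" using that by (intro continuous_on_subset[OF c]) auto
    moreover have d': "(f has_real_derivative f' z) (at z)" if "x < z" "z < y" for z
      using that \<open>x \<in> {a..b}\<close> \<open>y \<in> {a..b}\<close> by (intro d) auto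
    ultimately obtain k z where z: "x < z" "z < y" "(f has_real_derivative k) (at z)" "f y - f x = (y - x) * k"
      using MVT[OF \<open>x < y\<close>, of f] real_differentiable_def by blast
    then have "f y - f x = (y - x) * f' z"
      using DERIV_unique[OF z(3) d'] by simp
    with le[of z] \<open>x < y\<close> show ?thesis by (simp add: abs_mult mult.commute)
  qed
  show ?thesis
    using *[of x y] *[of y x] xy by (cases x y rule: linorder_cases) (auto simp: abs_minus_commute)
qed

text \<open>Makes the integral over a left half-line differentiable in its endpoint, by reduction to
  \<open>prim\<close>.\<close>

lemma integral_atMost_diff:
  fixes f :: "real \<Rightarrow> real"
  assumes c: "continuous_on UNIV f" and i: "\<And>a. integrable lborel (\<lambda>\<eta>. indicator {..a} \<eta> * f \<eta>)"
  shows "(\<integral>\<eta>. indicator {..x} \<eta> * f \<eta> \<partial>lborel) = (\<integral>\<eta>. indicator {..0} \<eta> * f \<eta> \<partial>lborel) + prim f x"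
proof -
  have [measurable]: "f \<in> borel_measurable borel" by (rule borel_measurable_continuous_onI[OF c])
  have *: "(\<integral>\<eta>. indicator {..b} \<eta> * f \<eta> \<partial>lborel) - (\<integral>\<eta>. indicator {..a} \<eta> * f \<eta> \<partial>lborel)
      = prim f b - prim f a" if "a \<le> b" for a b
  proof -
    have "(\<integral>\<eta>. indicator {..b} \<eta> * f \<eta> \<partial>lborel) - (\<integral>\<eta>. indicator {..a} \<eta> * f \<eta> \<partial>lborel)
      = (\<integral>\<eta>. indicator {..b} \<eta> * f \<eta> - indicator {..a} \<eta> * f \<eta> \<partial>lborel)"
      by (rule Bochner_Integration.integral_diff[symmetric]; rule i)
    also have "\<dots> = (\<integral>\<eta>. f \<eta> * indicator {a..b} \<eta> \<partial>lborel)"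
      by (rule integral_cong_AE) (use that AE_lborel_singleton[of a] in \<open>auto split: split_indicator\<close>)
    also have "\<dots> = prim f b - prim f a"
      using that by (rule integral_FTC_Icc_real)
        (use has_real_derivative_prim[OF c] c in \<open>auto simp: continuous_on_eq_continuous_at\<close>)
    finally show ?thesis .
  qed
  show ?thesis
    using *[of 0 x] *[of x 0] by (cases "0 \<le> x") auto
qed

locale rB_flow = rB_data +
  fixes B :: "real \<Rightarrow> real \<Rightarrow> real" and L :: real
  assumes adm: "adm B" and even: "\<And>s \<xi>. B s (- \<xi>) = B s \<xi>" and fixed: "\<And>s \<xi>. B s \<xi> = Phi B s \<xi>"
    and small: "T * C1 \<le> 1 / 2"
    and A0_pos: "\<And>\<xi>. \<xi> \<noteq> 0 \<Longrightarrow> A0 \<xi> > 0" and B0_inner: "\<And>\<xi>. \<bar>\<xi>\<bar> \<le> 1 \<Longrightarrow> B0 \<xi> = 1"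
    \<comment> \<open>the final profile \<open>u T\<close> has compact support\<close>
    and balance: "\<And>\<xi>. \<bar>\<xi>\<bar> \<ge> L \<Longrightarrow> prim (\<lambda>\<eta>. A0 \<eta> * B0 \<eta>) \<xi> = 0"
begin

abbreviation "A \<equiv> accum B"
abbreviation "Y \<equiv> pos B"
abbreviation "P \<equiv> \<lambda>s \<xi>. press B s (pos B s \<xi>)"

lemmas cont = b_cont'[OF adm] accum_cont'[OF adm] pos_cont'[OF adm] press_cont'[OF adm]

lemma B_clamp: "B (clamp s) \<xi> = B s \<xi>"
  by (subst (1 2) fixed) (simp add: Phi_def)

lemma A_clamp: "A (clamp s) \<xi> = A s \<xi>"
  by (simp add: accum_def)

lemma B_zero: "B 0 \<xi> = B0 \<xi>"
  using T by (subst fixed) (simp add: Phi_def)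

lemma A_zero: "A 0 \<xi> = A0 \<xi>"
  using T by (simp add: accum_def)

lemma prim_clamp_deriv:
  assumes s: "0 < s" "s < T" and f: "continuous_on UNIV f"
  shows "((\<lambda>s. prim f (clamp s)) has_real_derivative f s) (at s)"
proof (rule has_field_derivative_transform_within_open[of "prim f" _ _ "{0<..<T}"])
  show "(prim f has_real_derivative f s) (at s)" using f by (rule has_real_derivative_prim)
qed (use s in auto)

lemma A_deriv: "0 < s \<Longrightarrow> s < T \<Longrightarrow> ((\<lambda>s. A s \<xi>) has_real_derivative B s \<xi>) (at s)"
  unfolding accum_def
  by (auto intro!: derivative_eq_intros prim_clamp_deriv cont continuous_intros)

lemma B_deriv: "0 < s \<Longrightarrow> s < T \<Longrightarrow> ((\<lambda>s. B s \<xi>) has_real_derivative - (P s \<xi> * A s \<xi>) / 2) (at s)"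
proof -
  assume "0 < s" "s < T"
  then have "((\<lambda>s. Phi B s \<xi>) has_real_derivative - (P s \<xi> * A s \<xi>) / 2) (at s)"
    unfolding Phi_def
    by (auto intro!: derivative_eq_intros prim_clamp_deriv[where f = "\<lambda>r. P r \<xi> * A r \<xi>"] cont continuous_intros)
  then show ?thesis by (simp flip: fixed)
qed

text \<open>\<open>B\<close> starts at 1 there and, by \<open>Phi_near\<close>, loses at most
  1/2.\<close>

lemma B_inner: "\<bar>\<xi>\<bar> \<le> 1 \<Longrightarrow> B s \<xi> \<ge> 1 / 2"
  using Phi_near[OF adm small, of s \<xi>] B0_inner[of \<xi>] rho_le_1[OF l, of \<xi>]
  unfolding fixed[symmetric] by linarith

text \<open>Where \<open>A0\<close> may vanish, \<open>A\<close> grows at rate at least 1/2. This is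
  the mechanism that removes the singularity as soon as \<open>s > 0\<close>.\<close>

lemma A_inner:
  assumes "\<bar>\<xi>\<bar> \<le> 1"
  shows "A s \<xi> \<ge> A0 \<xi> + clamp s / 2"
proof -
  have "prim (\<lambda>r. B r \<xi>) 0 - 0 / 2 \<le> prim (\<lambda>r. B r \<xi>) (clamp s) - clamp s / 2"
  proof (rule DERIV_nonneg_imp_nondecreasing[OF clamp_bounds(1)], intro exI conjI)
    show "((\<lambda>s. prim (\<lambda>r. B r \<xi>) s - s / 2) has_real_derivative B x \<xi> - 1 / 2) (at x)" for x
      by (auto intro!: derivative_eq_intros has_real_derivative_prim cont continuous_intros)
    show "B x \<xi> - 1 / 2 \<ge> 0" for x using B_inner[OF assms] by simp
  qed
  then show ?thesis by (simp add: accum_def)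
qed

lemma A_lower: "A s \<xi> \<ge> clamp s / 2"
proof (cases "\<bar>\<xi>\<bar> \<le> 1")
  case True
  then show ?thesis using A_inner[OF True, of s] A0_bounds[of \<xi>] by linarith
next
  case False
  then show ?thesis using accum_outer[OF adm, of \<xi> s] clamp_bounds(2)[of s] T_le by linarith
qed

lemma A_pos: "\<xi> \<noteq> 0 \<Longrightarrow> A s \<xi> > 0"
  using A_inner[of \<xi> s] A0_pos[of \<xi>] clamp_bounds(1)[of s] accum_outer[OF adm, of \<xi> s]
  by (cases "\<bar>\<xi>\<bar> \<le> 1") (linarith, linarith)

lemma Y_deriv: "(Y s has_real_derivative (A s \<xi>)\<^sup>2) (at \<xi>)"
  by (rule pos_deriv[OF adm])

text \<open>The Jacobian can vanish only at 0, so monotonicity is strict on either side of 0, and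
  the two sides are joined there.\<close>

lemma Y_less:
  assumes "\<eta> < \<xi>"
  shows "Y s \<eta> < Y s \<xi>"
proof -
  have *: "Y s \<eta> < Y s \<xi>" if "\<eta> < \<xi>" "0 \<le> \<eta> \<or> \<xi> \<le> 0" for \<eta> \<xi>
  proof (rule DERIV_pos_imp_increasing_open[OF that(1)])
    fix x assume "\<eta> < x" "x < \<xi>"
    then have "A s x > 0" using that by (intro A_pos) auto
    then show "\<exists>y. (Y s has_real_derivative y) (at x) \<and> 0 < y"
      using Y_deriv by (intro exI[of _ "(A s x)\<^sup>2"]) auto
  qed (intro cont continuous_intros)
  show ?thesis
    using *[of \<eta> \<xi>] *[of \<eta> 0] *[of 0 \<xi>] assms by (cases "0 \<le> \<eta> \<or> \<xi> \<le> 0") auto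
qed

lemma Y_zero [simp]: "Y s 0 = 0"
  by (simp add: pos_def)

lemma Y_minus [simp]: "Y s (- \<xi>) = - Y s \<xi>"
  by (rule pos_odd[OF adm even])

lemma bij_Y: "bij (Y s)"
proof (rule bijI)
  show "inj (Y s)" using Y_less by (metis injI linorder_neqE_linordered_idom order_less_irrefl)
  have nonneg: "\<exists>\<xi>. Y s \<xi> = x" if "x \<ge> 0" for x
  proof -
    have "continuous_on {0..4 * x + 8} (Y s)" by (intro cont continuous_intros)
    \<comment> \<open>\<open>4 * x + 8\<close> is the solution \<open>y\<close> of
      \<open>y / 4 - 2 = x\<close>, the lower bound given by \<open>pos_expand\<close>.\<close>
    moreover have "x \<le> Y s (4 * x + 8)"
      using pos_expand[OF adm, of "4 * x + 8" 0 s] pos_mono[OF adm, of 0 "4 * x + 8" s] that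
      by (simp add: add_divide_distrib)
    ultimately show ?thesis using IVT'[of "Y s" 0 x "4 * x + 8"] that by auto
  qed
  have "\<exists>\<xi>. Y s \<xi> = x" for x
  proof (cases "x \<ge> 0")
    case False
    then obtain \<xi> where "Y s \<xi> = - x" using nonneg[of "- x"] by auto
    then have "Y s (- \<xi>) = x" using pos_odd[OF adm even, of s \<xi>] by simp
    then show ?thesis by blast
  qed (rule nonneg)
  then show "surj (Y s)" by (metis surjI)
qed

definition X :: "real \<Rightarrow> real \<Rightarrow> real" where "X s = inv (Y s)"

lemma X_Y [simp]: "X s (Y s \<xi>) = \<xi>"
  by (simp add: X_def bij_Y bij_is_inj)

lemma Y_X [simp]: "Y s (X s x) = x"
  by (simp add: X_def bij_Y bij_is_surj surj_f_inv_f)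

text \<open>Invariance of domain for \<open>(s, \<xi>) \<mapsto> (s, Y s \<xi>)\<close>. The inverse
  function theorem would fail at a zero of the Jacobian.\<close>

lemma X_cont: "continuous_on UNIV (\<lambda>(s, x). X s x)"
proof -
  define \<Psi> where "\<Psi> = (\<lambda>q. (fst q, Y (fst q) (snd q)))"
  have inj: "inj \<Psi>" unfolding \<Psi>_def by (rule injI) (metis X_Y fst_conv snd_conv prod_eq_iff)
  have c: "continuous_on UNIV \<Psi>" unfolding \<Psi>_def by (intro cont continuous_intros)
  obtain g where g: "homeomorphism UNIV (\<Psi> ` UNIV) \<Psi> g"
    using invariance_of_domain_homeomorphism[OF open_UNIV c _ inj] by auto
  have surj: "\<Psi> (s, X s x) = (s, x)" for s x by (simp add: \<Psi>_def)
  then have "\<Psi> ` UNIV = UNIV" by (metis surj_def surj_pair)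
  moreover have "g (s, x) = (s, X s x)" for s x
    using g surj unfolding homeomorphism_def by (metis UNIV_I)
  ultimately have "continuous_on UNIV (\<lambda>q. (fst q, X (fst q) (snd q)))"
    using g unfolding homeomorphism_def by (metis (no_types, lifting) continuous_on_cong prod.collapse)
  then show ?thesis
    using continuous_on_snd by (fastforce simp: split_beta)
qed

lemmas X_cont' = continuous_on_Pair_compose[OF X_cont]

section \<open>Velocity and pressure gradient along the flow\<close>

text \<open>The time derivative of \<open>Y\<close>, so the velocity in reversed time; the solution
  is \<open>- W\<close> in Eulerian coordinates.\<close>

definition W :: "real \<Rightarrow> real \<Rightarrow> real" where
  "W s = prim (\<lambda>\<eta>. 2 * A s \<eta> * B s \<eta>)"

text \<open>This is \<open>l P_x\<close> at the point \<open>Y s \<xi>\<close>: the relation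
  \<open>l^2 P_xx = P - v^2 / 2\<close> reads \<open>l R' = P A^2 - 2 B^2\<close> in \<xi>, and
  \<open>P_x\<close> vanishes at 0 because \<open>P\<close> is even. With this form
  \<open>W_deriv_time\<close> follows from the linear system; that \<open>R\<close> is the gradient
  is shown in \<open>P_deriv\<close>.\<close>

definition R :: "real \<Rightarrow> real \<Rightarrow> real" where
  "R s \<xi> = prim (\<lambda>\<eta>. P s \<eta> * (A s \<eta>)\<^sup>2 - 2 * (B s \<eta>)\<^sup>2) \<xi> / l"

lemma W_cont: "continuous_on UNIV (\<lambda>(s, \<xi>). W s \<xi>)"
  unfolding W_def by (rule continuous_on_prim_param) (auto simp: split_beta intro!: cont continuous_intros)

lemma R_cont: "continuous_on UNIV (\<lambda>(s, \<xi>). R s \<xi>)"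
proof -
  have "continuous_on UNIV (\<lambda>(s, \<xi>). prim (\<lambda>\<eta>. P s \<eta> * (A s \<eta>)\<^sup>2 - 2 * (B s \<eta>)\<^sup>2) \<xi>)"
    by (rule continuous_on_prim_param) (auto simp: split_beta intro!: cont continuous_intros)
  then show ?thesis using l unfolding R_def split_beta by (intro continuous_intros) auto
qed

lemmas cont2 = cont X_cont' continuous_on_Pair_compose[OF W_cont] continuous_on_Pair_compose[OF R_cont]

lemma W_clamp: "W (clamp s) \<xi> = W s \<xi>"
  by (simp add: W_def A_clamp B_clamp)

lemma W_deriv: "(W s has_real_derivative 2 * A s \<xi> * B s \<xi>) (at \<xi>)"
  unfolding W_def by (rule has_real_derivative_prim) (intro cont continuous_intros)

lemma Y_deriv_time:
  assumes "0 < s" "s < T"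
  shows "((\<lambda>s. Y s \<xi>) has_real_derivative W s \<xi>) (at s)"
  unfolding pos_def W_def
  by (rule has_real_derivative_prim_param[of "{0<..<T}"])
    (use assms in \<open>auto simp: split_beta intro!: derivative_eq_intros A_deriv cont continuous_intros\<close>)

lemma W_deriv_time:
  assumes "0 < s" "s < T"
  shows "((\<lambda>s. W s \<xi>) has_real_derivative - l * R s \<xi>) (at s)"
proof -
  have "((\<lambda>s. W s \<xi>) has_real_derivative prim (\<lambda>\<eta>. 2 * (B s \<eta>)\<^sup>2 - P s \<eta> * (A s \<eta>)\<^sup>2) \<xi>) (at s)"
    unfolding W_def
    by (rule has_real_derivative_prim_param[of "{0<..<T}"])
      (use assms in \<open>auto simp: split_beta power2_eq_square intro!: derivative_eq_intros A_deriv B_deriv cont continuous_intros\<close>)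
  also have "prim (\<lambda>\<eta>. 2 * (B s \<eta>)\<^sup>2 - P s \<eta> * (A s \<eta>)\<^sup>2) \<xi> = - l * R s \<xi>"
  proof (subst prim_eq[where F = "\<lambda>\<xi>. - l * R s \<xi>"])
    have c: "continuous_on UNIV (\<lambda>\<eta>. P s \<eta> * (A s \<eta>)\<^sup>2 - 2 * (B s \<eta>)\<^sup>2)"
      by (intro cont continuous_intros)
    show "((\<lambda>\<xi>. - l * R s \<xi>) has_real_derivative 2 * (B s x)\<^sup>2 - P s x * (A s x)\<^sup>2) (at x)" for x
      using l unfolding R_def by (auto intro!: derivative_eq_intros has_real_derivative_prim[OF c])
  qed (simp add: R_def)
  finally show ?thesis .
qed

text \<open>Splitting the integral for \<open>P\<close> at \<open>\<xi>\<close> and using the symmetry \<open>\<eta> \<mapsto> - \<eta>\<close> writes \<open>l P\<close> as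
  \<open>exp (- Y / l) F(\<xi>) + exp (Y / l) F(- \<xi>)\<close>, and \<open>l R\<close> is the difference of the same two terms.\<close>

lemma P_deriv: "(P s has_real_derivative (A s \<xi>)\<^sup>2 * R s \<xi> / l) (at \<xi>)"
  and R_bound: "\<bar>R s \<xi>\<bar> \<le> P s \<xi>"
proof -
  define f where "f \<eta> = exp (Y s \<eta> / l) * (B s \<eta>)\<^sup>2" for \<eta>
  define F where "F x = (\<integral>\<eta>. indicator {..0} \<eta> * f \<eta> \<partial>lborel) + prim f x" for x
  define S where "S x = exp (Y s x / l) * F (- x) - exp (- Y s x / l) * F x" for x
  have cf: "continuous_on UNIV f" using l unfolding f_def by (intro cont continuous_intros) auto
  have [measurable]: "f \<in> borel_measurable borel" by (rule borel_measurable_continuous_onI[OF cf])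
  \<comment> \<open>For \<open>\<eta> \<le> x\<close> monotonicity of \<open>Y\<close> resolves the
    absolute value, so integrability of \<open>f\<close> on left half-lines is inherited from the
    kernel.\<close>
  have kern_le: "indicator {..x} \<eta> * f \<eta> = exp (Y s x / l) * l * (indicator {..x} \<eta> * kern B s (Y s x) \<eta>)" for x \<eta>
  proof (cases "\<eta> \<le> x")
    case True
    then have "exp (- (\<bar>Y s x - Y s \<eta>\<bar> / l)) = exp (Y s \<eta> / l) / exp (Y s x / l)"
      using pos_mono[OF adm True, of s] by (simp add: diff_divide_distrib flip: exp_diff)
    then show ?thesis using l True by (simp add: f_def kern_def)
  qed simp
  have int: "integrable lborel (\<lambda>\<eta>. indicator {..x} \<eta> * f \<eta>)" for x
    unfolding kern_le
    by (intro integrable_mult_right integrable_real_mult_indicator[of _ lborel "kern B s (Y s x)", simplified mult.commute] kern_integrable adm) auto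
  have F: "F x = (\<integral>\<eta>. indicator {..x} \<eta> * f \<eta> \<partial>lborel)" for x
    unfolding F_def by (rule integral_atMost_diff[OF cf int, symmetric])
  have F_nonneg: "F x \<ge> 0" for x unfolding F by (rule Bochner_Integration.integral_nonneg) (simp add: f_def)
  have F': "(F has_real_derivative f x) (at x)" for x
    unfolding F_def by (auto intro!: derivative_eq_intros has_real_derivative_prim cf)
  have lP: "P s x = (exp (- Y s x / l) * F x + exp (Y s x / l) * F (- x)) / l" for x
  proof -
    have int': "integrable lborel (\<lambda>\<eta>. indicator {x..} \<eta> * f (- \<eta>))"
      using lborel_integrable_real_affine[OF int[of "- x"], of "-1" 0] by (simp add: indicator_def)
    have "(\<integral>\<eta>. indicator {x..} \<eta> * f (- \<eta>) \<partial>lborel) = F (- x)"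
      unfolding F using lborel_integral_real_affine[of "-1" "\<lambda>\<eta>. indicator {..- x} \<eta> * f \<eta>" 0]
      by (simp add: indicator_def)
    then have "(exp (- Y s x / l) * F x + exp (Y s x / l) * F (- x)) / l
      = (\<integral>\<eta>. (exp (- Y s x / l) * (indicator {..x} \<eta> * f \<eta>) + exp (Y s x / l) * (indicator {x..} \<eta> * f (- \<eta>))) / l \<partial>lborel)"
      using int[of x] int' by (simp add: F)
    also have "\<dots> = P s x"
      unfolding press_def
    proof (rule integral_cong_AE)
      show "AE \<eta> in lborel. (exp (- Y s x / l) * (indicator {..x} \<eta> * f \<eta>) + exp (Y s x / l) * (indicator {x..} \<eta> * f (- \<eta>))) / l
         = kern B s (Y s x) \<eta>"
        using AE_lborel_singleton[of x]
      proof eventually_elim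
        case (elim \<eta>)
        then show ?case
          using l pos_mono[OF adm, of \<eta> x s] pos_mono[OF adm, of x \<eta> s]
          by (cases "\<eta> < x") (auto simp: f_def even kern_def diff_divide_distrib simp flip: exp_add mult.assoc)
      qed
    qed (auto intro: kern_measurable adm)
    finally show ?thesis by simp
  qed
  have E1: "((\<lambda>x. exp (Y s x / l)) has_real_derivative exp (Y s x / l) * ((A s x)\<^sup>2 / l)) (at x)" for x
    using l by (auto intro!: derivative_eq_intros Y_deriv)
  have E2: "((\<lambda>x. exp (- Y s x / l)) has_real_derivative exp (- Y s x / l) * (- (A s x)\<^sup>2 / l)) (at x)" for x
    using l by (auto intro!: derivative_eq_intros Y_deriv)
  have F2: "((\<lambda>x. F (- x)) has_real_derivative - f (- x)) (at x)" for x
    using DERIV_chain2[OF F' DERIV_minus[OF DERIV_ident]] by simp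
  have e: "f x * exp (- Y s x / l) = (B s x)\<^sup>2" "- f (- x) * exp (Y s x / l) = - ((B s x)\<^sup>2)" for x
    by (simp_all add: f_def even mult_ac flip: exp_add)
  have S': "(S has_real_derivative P s x * (A s x)\<^sup>2 - 2 * (B s x)\<^sup>2) (at x)" for x
    unfolding S_def
    by (rule DERIV_cong[OF DERIV_diff[OF DERIV_mult[OF E1 F2] DERIV_mult[OF E2 F']]], unfold e lP)
      (simp add: algebra_simps add_divide_distrib)
  \<comment> \<open>Both sides have the derivative in \<open>S'\<close> and vanish at 0, the left
    one because \<open>Y s 0 = 0\<close>.\<close>
  have S: "S x = l * R s x" for x
    unfolding R_def using l by (subst prim_eq[OF S']) (simp add: S_def)
  have "((\<lambda>x. (exp (- Y s x / l) * F x + exp (Y s x / l) * F (- x)) / l) has_real_derivative (A s \<xi>)\<^sup>2 * (S \<xi> / l) / l) (at \<xi>)"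
    by (rule DERIV_cong[OF DERIV_cdivide[OF DERIV_add[OF DERIV_mult[OF E2 F'] DERIV_mult[OF E1 F2]]]], unfold e S_def)
      (simp add: algebra_simps diff_divide_distrib)
  then show "(P s has_real_derivative (A s \<xi>)\<^sup>2 * R s \<xi> / l) (at \<xi>)"
    using l by (simp add: lP S)
  have "\<bar>S \<xi>\<bar> \<le> exp (- Y s \<xi> / l) * F \<xi> + exp (Y s \<xi> / l) * F (- \<xi>)"
    using F_nonneg[of \<xi>] F_nonneg[of "- \<xi>"] by (auto simp: S_def abs_le_iff)
  then show "\<bar>R s \<xi>\<bar> \<le> P s \<xi>"
    using l by (simp add: lP S abs_mult field_simps)
qed

lemma R_bound': "\<bar>R s \<xi>\<bar> \<le> C1 * rho l \<xi>"
  using R_bound press_pos_bound[OF adm] by (rule order_trans)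

lemma W_Lipschitz:
  assumes "s \<in> {0..T}" "s' \<in> {0..T}"
  shows "\<bar>W s \<xi> - W s' \<xi>\<bar> \<le> l * C1 * rho l \<xi> * \<bar>s - s'\<bar>"
proof (rule interior_derivative_bound[OF _ _ _ assms])
  show "continuous_on {0..T} (\<lambda>s. W s \<xi>)" by (intro cont2 continuous_intros)
  show "\<bar>- l * R s \<xi>\<bar> \<le> l * C1 * rho l \<xi>" for s
    using R_bound'[of s \<xi>] l by (simp add: abs_mult)
qed (rule W_deriv_time)

text \<open>At \<open>s = 0\<close> the velocity has compact support by \<open>balance\<close>; its
  change up to time \<open>s\<close> is the time integral of \<open>- l * R\<close>, and
  \<open>R\<close> decays like the pressure.\<close>

lemma W_decay: obtains K where "K \<ge> 0" "\<And>s \<xi>. \<bar>W s \<xi>\<bar> \<le> K * rho l \<xi>"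
proof -
  have "continuous_on {-\<bar>L\<bar>..\<bar>L\<bar>} (W 0)" by (intro cont2 continuous_intros)
  then have "bounded (W 0 ` {-\<bar>L\<bar>..\<bar>L\<bar>})"
    by (intro compact_imp_bounded compact_continuous_image) auto
  then obtain C where "\<forall>y \<in> W 0 ` {-\<bar>L\<bar>..\<bar>L\<bar>}. norm y \<le> C"
    unfolding bounded_iff by blast
  then have C: "\<bar>W 0 \<xi>\<bar> \<le> C" if "\<bar>\<xi>\<bar> \<le> \<bar>L\<bar>" for \<xi>
    using that by (auto simp: abs_le_iff[of \<xi>])
  then have "C \<ge> 0" using order_trans[OF abs_ge_zero C[of 0]] by simp
  have 0: "\<bar>W 0 \<xi>\<bar> \<le> C / rho l L * rho l \<xi>" for \<xi>
  proof (cases "\<bar>\<xi>\<bar> \<le> \<bar>L\<bar>")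
    case True
    then have "rho l L \<le> rho l \<xi>" using l by (simp add: rho_def divide_right_mono)
    then have "C * 1 \<le> C * (rho l \<xi> / rho l L)"
      using \<open>C \<ge> 0\<close> by (intro mult_left_mono) (auto simp: field_simps)
    then show ?thesis using C[OF True] by simp
  next
    case False
    have "prim (\<lambda>\<eta>. 2 * (A0 \<eta> * B0 \<eta>)) \<xi> = 2 * prim (\<lambda>\<eta>. A0 \<eta> * B0 \<eta>) \<xi>"
      by (subst prim_eq[where F = "\<lambda>\<xi>. 2 * prim (\<lambda>\<eta>. A0 \<eta> * B0 \<eta>) \<xi>"])
        (auto intro!: derivative_eq_intros has_real_derivative_prim continuous_intros A0_cont B0_cont)
    then show ?thesis using balance[of \<xi>] False \<open>C \<ge> 0\<close> by (simp add: W_def A_zero B_zero mult.assoc)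
  qed
  show thesis
  proof
    show "C / rho l L + l * C1 * T \<ge> 0" using \<open>C \<ge> 0\<close> l C_nonneg T by auto
    show "\<bar>W s \<xi>\<bar> \<le> (C / rho l L + l * C1 * T) * rho l \<xi>" for s \<xi>
    proof -
      have "\<bar>W (clamp s) \<xi> - W 0 \<xi>\<bar> \<le> l * C1 * rho l \<xi> * \<bar>clamp s - 0\<bar>"
        by (rule W_Lipschitz) (use clamp_bounds T in auto)
      also have "\<dots> \<le> l * C1 * rho l \<xi> * T"
        using l C_nonneg clamp_bounds by (intro mult_left_mono) auto
      finally have "\<bar>W s \<xi> - W 0 \<xi>\<bar> \<le> l * C1 * T * rho l \<xi>" by (simp add: W_clamp mult_ac)
      with 0[of \<xi>] show ?thesis unfolding distrib_right by linarith
    qed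
  qed
qed

section \<open>Passage between Eulerian and Lagrangian integrals\<close>

lemma distr_Y: "distr (density lborel (\<lambda>\<xi>. ennreal ((A s \<xi>)\<^sup>2))) borel (Y s) = lborel"
  by (rule lborel_distr_density[OF Y_deriv _ _ bij_Y]) (auto intro!: cont continuous_intros)

lemma A_measurable [measurable]: "A s \<in> borel_measurable borel"
  and B_measurable [measurable]: "B s \<in> borel_measurable borel"
  and Y_measurable [measurable]: "Y s \<in> borel_measurable borel"
  and X_measurable [measurable]: "X s \<in> borel_measurable borel"
  and W_measurable [measurable]: "W s \<in> borel_measurable borel"
  by (intro borel_measurable_continuous_onI cont2 continuous_intros)+

lemma nn_integral_Y:
  assumes [measurable]: "f \<in> borel_measurable borel"
  shows "(\<integral>\<^sup>+x. f x \<partial>lborel) = (\<integral>\<^sup>+\<xi>. ennreal ((A s \<xi>)\<^sup>2) * f (Y s \<xi>) \<partial>lborel)"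
  by (subst distr_Y[of s, symmetric], subst nn_integral_distr, simp, simp, subst nn_integral_density) auto

lemma integral_Y:
  fixes f :: "real \<Rightarrow> real"
  assumes [measurable]: "f \<in> borel_measurable borel"
  shows "(\<integral>x. f x \<partial>lborel) = (\<integral>\<xi>. (A s \<xi>)\<^sup>2 * f (Y s \<xi>) \<partial>lborel)"
    and "integrable lborel f \<longleftrightarrow> integrable lborel (\<lambda>\<xi>. (A s \<xi>)\<^sup>2 * f (Y s \<xi>))"
  by (subst distr_Y[of s, symmetric], subst integral_distr, simp, simp, subst integral_real_density, simp, simp, simp, simp)
    (subst distr_Y[of s, symmetric], subst integrable_distr_eq, simp, simp, subst integrable_real_density, simp, simp, simp, simp)

lemma distr_Y_time:
  "distr (density lborel (\<lambda>(t, \<xi>). ennreal ((A (T - t) \<xi>)\<^sup>2))) borel (\<lambda>(t, \<xi>). (t, Y (T - t) \<xi>)) = lborel"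
  by (rule lborel_distr_density_fibre[OF Y_deriv _ _ bij_Y])
    (auto simp: split_beta intro!: cont continuous_intros)

lemma B_sq_integrable: "integrable lborel (\<lambda>\<xi>. (B s \<xi>)\<^sup>2)"
  and B_sq_integral: "(\<integral>\<xi>. (B s \<xi>)\<^sup>2 \<partial>lborel) \<le> M\<^sup>2 * mass"
proof -
  show i: "integrable lborel (\<lambda>\<xi>. (B s \<xi>)\<^sup>2)"
    by (rule Bochner_Integration.integrable_bound[OF integrable_mult_right[OF integrable_rho[OF l], of "M\<^sup>2"]])
      (use b_sq_le'[OF adm] in auto)
  have "(\<integral>\<xi>. (B s \<xi>)\<^sup>2 \<partial>lborel) \<le> (\<integral>\<xi>. M\<^sup>2 * rho l \<xi> \<partial>lborel)"
    by (intro integral_mono i integrable_mult_right integrable_rho l b_sq_le' adm)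
  then show "(\<integral>\<xi>. (B s \<xi>)\<^sup>2 \<partial>lborel) \<le> M\<^sup>2 * mass" by (simp add: mass_def)
qed

end

subsection \<open>The solution\<close>

lemma continuous_set_integrable:
  fixes f :: "'a::euclidean_space \<Rightarrow> real"
  assumes "continuous_on UNIV f" "compact K"
  shows "set_integrable lborel K f"
  unfolding set_integrable_def
  by (rule borel_integrable_compact) (use assms in \<open>auto intro: continuous_on_subset\<close>)

lemma smooth_frechet:
  assumes "smooth \<phi>"
  shows "(\<phi> has_derivative frechet_derivative \<phi> (at x)) (at x)" "smooth (\<lambda>x. frechet_derivative \<phi> (at x) b)"
  using assms by (auto elim: smooth.cases simp: frechet_derivative_works)

lemma smooth_continuous: "smooth \<phi> \<Longrightarrow> continuous_on UNIV \<phi>"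
  by (meson continuous_at_imp_continuous_on has_derivative_continuous smooth_frechet(1))

lemma frechet_derivative_outside_support:
  assumes "x \<notin> closure {x. \<phi> x \<noteq> (0::real)}"
  shows "frechet_derivative \<phi> (at x) = (\<lambda>_. 0)"
proof -
  have "(\<phi> has_derivative (\<lambda>_. 0)) (at x)"
    by (rule has_derivative_transform_within_open[of "\<lambda>_. 0" _ _ _ "- closure {x. \<phi> x \<noteq> 0}"])
      (use assms closure_subset in \<open>auto simp: subset_eq\<close>)
  then show ?thesis by (rule frechet_derivative_at[symmetric])
qed

lemma smooth_real_derivative:
  fixes \<phi> :: "real \<Rightarrow> real"
  assumes "smooth \<phi>"
  shows "(\<phi> has_real_derivative deriv \<phi> x) (at x)" "continuous_on UNIV (deriv \<phi>)"
    "x \<notin> closure {x. \<phi> x \<noteq> 0} \<Longrightarrow> deriv \<phi> x = 0"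
proof -
  have d: "(\<phi> has_real_derivative frechet_derivative \<phi> (at x) 1) (at x)" for x
  proof -
    note D = smooth_frechet(1)[OF assms, of x]
    have "frechet_derivative \<phi> (at x) h = frechet_derivative \<phi> (at x) 1 * h" for h
      using linear_scale[OF has_derivative_linear[OF D], of h 1] by simp
    then show ?thesis
      unfolding has_field_derivative_def by (intro has_derivative_eq_rhs[OF D] ext)
  qed
  then have e: "deriv \<phi> = (\<lambda>x. frechet_derivative \<phi> (at x) 1)"
    by (auto intro: DERIV_imp_deriv)
  show "(\<phi> has_real_derivative deriv \<phi> x) (at x)" using d e by simp
  show "continuous_on UNIV (deriv \<phi>)"
    unfolding e by (intro smooth_continuous smooth_frechet assms)
  show "deriv \<phi> x = 0" if "x \<notin> closure {x. \<phi> x \<noteq> 0}"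
    using frechet_derivative_outside_support[OF that] e by simp
qed

lemma smooth_chain:
  fixes \<phi> :: "real \<times> real \<Rightarrow> real"
  assumes "smooth \<phi>" "(a has_real_derivative a') (at t)" "(b has_real_derivative b') (at t)"
  shows "((\<lambda>t. \<phi> (a t, b t)) has_real_derivative
      a' * frechet_derivative \<phi> (at (a t, b t)) (1, 0) + b' * frechet_derivative \<phi> (at (a t, b t)) (0, 1)) (at t)"
proof -
  let ?D = "frechet_derivative \<phi> (at (a t, b t))"
  have D: "(\<phi> has_derivative ?D) (at (a t, b t))" by (rule smooth_frechet(1)) fact
  then have lin: "linear ?D" by (rule has_derivative_linear)
  have "((\<lambda>t. (a t, b t)) has_derivative (\<lambda>h. (a' * h, b' * h))) (at t)"
    using assms(2,3) by (intro has_derivative_Pair) (simp_all add: has_field_derivative_def)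
  from has_derivative_compose[OF this D]
  have "((\<lambda>t. \<phi> (a t, b t)) has_derivative (\<lambda>h. ?D (a' * h, b' * h))) (at t)" .
  moreover have "?D (a' * h, b' * h) = (a' * ?D (1, 0) + b' * ?D (0, 1)) * h" for h
  proof -
    have "(a' * h, b' * h) = (a' * h) *\<^sub>R (1, 0) + (b' * h) *\<^sub>R (0, 1 :: real)" by simp
    then show ?thesis
      by (simp only: linear_add[OF lin] linear_scale[OF lin]) (simp add: algebra_simps)
  qed
  ultimately show ?thesis by (simp add: has_field_derivative_def)
qed

text \<open>For \<open>|h| \<le> 1\<close>, \<open>ln x < x\<close> applied to a power of
  \<open>1 / |h|\<close> bounds \<open>|h| |ln |h||^\<delta>\<close> by
  \<open>\<delta> powr \<delta>\<close>; for larger \<open>|h|\<close> both factors increase up to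
  \<open>m\<close>. A bounded integrable derivative therefore has finite weighted energy.\<close>

lemma log_weight_bound:
  assumes "\<delta> > 0" "\<bar>h\<bar> \<le> m"
  shows "h\<^sup>2 * log_weight \<delta> h \<le> (\<delta> powr \<delta> + m * \<bar>ln m\<bar> powr \<delta>) * \<bar>h\<bar>"
proof (cases "h = 0")
  case False
  then have h: "\<bar>h\<bar> > 0" "m > 0" using assms by auto
  have "\<bar>h\<bar> * \<bar>ln \<bar>h\<bar>\<bar> powr \<delta> \<le> \<delta> powr \<delta> + m * \<bar>ln m\<bar> powr \<delta>"
  proof (cases "\<bar>h\<bar> \<le> 1")
    case True
    have "- ln \<bar>h\<bar> = ln ((1 / \<bar>h\<bar>) powr (1 / \<delta>)) * \<delta>"
      using h assms by (simp add: ln_powr ln_div)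
    also have "\<dots> \<le> (1 / \<bar>h\<bar>) powr (1 / \<delta>) * \<delta>"
      using h assms by (intro mult_right_mono less_imp_le[OF ln_less_self]) auto
    finally have "\<bar>ln \<bar>h\<bar>\<bar> \<le> (1 / \<bar>h\<bar>) powr (1 / \<delta>) * \<delta>" using True h by simp
    then have "\<bar>ln \<bar>h\<bar>\<bar> powr \<delta> \<le> ((1 / \<bar>h\<bar>) powr (1 / \<delta>) * \<delta>) powr \<delta>"
      using assms by (intro powr_mono2) auto
    also have "\<dots> = \<delta> powr \<delta> / \<bar>h\<bar>"
      using h assms by (simp add: powr_mult powr_powr)
    finally have "\<bar>h\<bar> * \<bar>ln \<bar>h\<bar>\<bar> powr \<delta> \<le> \<delta> powr \<delta>" using h by (simp add: field_simps)
    moreover have "m * \<bar>ln m\<bar> powr \<delta> \<ge> 0" using h by simp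
    ultimately show ?thesis by linarith
  next
    case False
    then have "\<bar>h\<bar> * \<bar>ln \<bar>h\<bar>\<bar> powr \<delta> \<le> m * \<bar>ln m\<bar> powr \<delta>"
      using assms h by (intro mult_mono powr_mono2) auto
    then show ?thesis using powr_ge_zero[of \<delta> \<delta>] by linarith
  qed
  then have "(\<bar>h\<bar> * \<bar>ln \<bar>h\<bar>\<bar> powr \<delta>) * \<bar>h\<bar> \<le> (\<delta> powr \<delta> + m * \<bar>ln m\<bar> powr \<delta>) * \<bar>h\<bar>"
    using h by (intro mult_right_mono) auto
  moreover have "h\<^sup>2 * log_weight \<delta> h = (\<bar>h\<bar> * \<bar>ln \<bar>h\<bar>\<bar> powr \<delta>) * \<bar>h\<bar>"
    by (simp add: log_weight_def mult_ac power2_eq_square flip: abs_mult)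
  ultimately show ?thesis by simp
qed (use assms in simp)

lemma nn_integral_inverse_infinite:
  assumes "e > (0::real)"
  shows "(\<integral>\<^sup>+\<xi>. ennreal (1 / \<xi>) * indicator {0<..e} \<xi> \<partial>lborel) = \<infinity>"
proof (rule ccontr)
  let ?I = "\<integral>\<^sup>+\<xi>. ennreal (1 / \<xi>) * indicator {0<..e} \<xi> \<partial>lborel"
  assume "?I \<noteq> \<infinity>"
  then obtain r where r: "r \<ge> 0" "?I = ennreal r" by (cases ?I) auto
  \<comment> \<open>Chosen so that the integral of \<open>1 / \<xi>\<close> over
    \<open>{a..e}\<close> is \<open>r + 1\<close>, more than the supposed total
    \<open>r\<close>.\<close>
  define a where "a = e * exp (- (r + 1))"
  have a: "0 < a" "a \<le> e" using assms r by (auto simp: a_def)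
  have "(\<integral>\<^sup>+\<xi>. ennreal (1 / \<xi>) * indicator {a..e} \<xi> \<partial>lborel) = ennreal (ln e - ln a)"
    by (rule nn_integral_FTC_Icc) (use a in \<open>auto intro!: derivative_eq_intros\<close>)
  moreover have "(\<integral>\<^sup>+\<xi>. ennreal (1 / \<xi>) * indicator {a..e} \<xi> \<partial>lborel) \<le> ?I"
    using a by (intro nn_integral_mono) (auto split: split_indicator)
  moreover have "ln e - ln a = r + 1" using assms by (simp add: a_def ln_mult)
  ultimately show False using r by simp
qed

section \<open>The solution in Eulerian coordinates\<close>

context rB_flow
begin

definition u :: "real \<Rightarrow> real \<Rightarrow> real" where "u t x = - W (T - t) (X (T - t) x)"

text \<open>Where \<open>A\<close> vanishes the division returns 0. By \<open>A_pos\<close> this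
  concerns at most the label 0, hence a null set for each \<open>t\<close>.\<close>

definition v :: "real \<Rightarrow> real \<Rightarrow> real" where
  "v t x = - 2 * B (T - t) (X (T - t) x) / A (T - t) (X (T - t) x)"

lemma u_Y [simp]: "u t (Y (T - t) \<xi>) = - W (T - t) \<xi>"
  by (simp add: u_def)

lemma v_Y: "v t (Y (T - t) \<xi>) = - 2 * B (T - t) \<xi> / A (T - t) \<xi>"
  by (simp add: v_def)

text \<open>Also true at a zero of \<open>A\<close>, where both sides are 0. The quadratic analogue
  excludes the label 0, because \<open>B\<close> need not vanish there.\<close>

lemma A_sq_v: "(A (T - t) \<xi>)\<^sup>2 * v t (Y (T - t) \<xi>) = - (2 * A (T - t) \<xi> * B (T - t) \<xi>)"
  by (simp add: v_Y power2_eq_square)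

lemma A_sq_v_sq: "\<xi> \<noteq> 0 \<Longrightarrow> (A (T - t) \<xi>)\<^sup>2 * (v t (Y (T - t) \<xi>))\<^sup>2 = 4 * (B (T - t) \<xi>)\<^sup>2"
  using A_pos[of \<xi> "T - t"] by (simp add: v_Y power_divide power_mult_distrib)

lemma u_cont: "continuous_on UNIV (\<lambda>(t, x). u t x)"
  unfolding u_def split_beta by (intro cont2 continuous_intros)

lemma u_measurable [measurable]: "u t \<in> borel_measurable borel"
  unfolding u_def[abs_def] by measurable

lemma v_measurable [measurable]: "v t \<in> borel_measurable borel"
  unfolding v_def[abs_def] by measurable

lemma v_joint: "(\<lambda>(t, x). v t x) \<in> borel_measurable borel"
  unfolding v_def split_beta
  by (intro borel_measurable_divide borel_measurable_times borel_measurable_continuous_onI cont2 continuous_intros)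

lemma jointly_measurable_u: "jointly_measurable T u" and jointly_measurable_v: "jointly_measurable T v"
  unfolding jointly_measurable_def
  using borel_measurable_continuous_onI[OF u_cont] v_joint by (auto intro: measurable_restrict_space1)

lemma v_sq_integrable: "integrable lborel (\<lambda>x. (v t x)\<^sup>2)"
  and v_sq_integral: "(\<integral>x. (v t x)\<^sup>2 \<partial>lborel) = 4 * (\<integral>\<xi>. (B (T - t) \<xi>)\<^sup>2 \<partial>lborel)"
proof -
  have AE: "AE \<xi> in lborel. (A (T - t) \<xi>)\<^sup>2 * (v t (Y (T - t) \<xi>))\<^sup>2 = 4 * (B (T - t) \<xi>)\<^sup>2"
    using AE_lborel_singleton[of 0] by eventually_elim (rule A_sq_v_sq)
  have "integrable lborel (\<lambda>\<xi>. 4 * (B (T - t) \<xi>)\<^sup>2)"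
    using B_sq_integrable by simp
  then show "integrable lborel (\<lambda>x. (v t x)\<^sup>2)"
    by (subst integral_Y(2)[of _ "T - t"], simp, subst integrable_cong_AE[OF _ _ AE]) auto
  show "(\<integral>x. (v t x)\<^sup>2 \<partial>lborel) = 4 * (\<integral>\<xi>. (B (T - t) \<xi>)\<^sup>2 \<partial>lborel)"
    by (subst integral_Y(1)[of _ "T - t"], simp, subst integral_cong_AE[OF _ _ AE]) auto
qed

lemma v_integrable: "integrable lborel (v t)"
proof (subst integral_Y(2)[of _ "T - t"])
  show "integrable lborel (\<lambda>\<xi>. (A (T - t) \<xi>)\<^sup>2 * v t (Y (T - t) \<xi>))"
    unfolding A_sq_v
  proof (rule Bochner_Integration.integrable_bound[OF integrable_mult_right[OF integrable_rho[OF l], of "3 * M"]])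
    show "AE \<xi> in lborel. norm (- (2 * A (T - t) \<xi> * B (T - t) \<xi>)) \<le> norm (3 * M * rho l \<xi>)"
    proof (rule AE_I2)
      fix \<xi>
      have "2 * \<bar>A (T - t) \<xi>\<bar> * \<bar>B (T - t) \<xi>\<bar> \<le> 3 * (M * rho l \<xi>)"
        using accum_bound[OF adm, of "T - t" \<xi>] by (intro mult_mono b_bound adm) auto
      then show "norm (- (2 * A (T - t) \<xi> * B (T - t) \<xi>)) \<le> norm (3 * M * rho l \<xi>)"
        using M by (simp add: abs_mult)
    qed
  qed measurable
qed simp

text \<open>In Lagrangian coordinates both integrands become continuous with compact support, and
  they combine to the derivative of \<open>W \<phi>(Y)\<close>. This covers the final time too,
  where \<open>u\<close> has no classical derivative bound.\<close>

lemma weak_deriv_u: "has_weak_deriv (u t) (v t)"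
  unfolding has_weak_deriv_def
proof (intro conjI allI impI)
  let ?s = "T - t"
  show "loc_integrable_on UNIV (u t)"
    unfolding loc_integrable_on_def
    by (intro allI impI continuous_set_integrable continuous_on_Pair_compose[OF u_cont] continuous_intros) auto
  show "loc_integrable_on UNIV (v t)"
    unfolding loc_integrable_on_def set_integrable_def
    by (intro allI impI integrable_mult_indicator v_integrable) (auto intro: borel_compact)
  fix \<phi> :: "real \<Rightarrow> real" assume "test_function_on UNIV \<phi>"
  then have sm: "smooth \<phi>" and K: "compact (closure {x. \<phi> x \<noteq> 0})"
    by (auto simp: test_function_on_def)
  note d = smooth_real_derivative[OF sm]
  have [measurable]: "\<phi> \<in> borel_measurable borel" "deriv \<phi> \<in> borel_measurable borel"
    by (intro borel_measurable_continuous_onI smooth_continuous sm d)+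
  define K' where "K' = X ?s ` closure {x. \<phi> x \<noteq> 0}"
  have K': "compact K'" unfolding K'_def
    by (intro compact_continuous_image K cont2 continuous_intros)
  have out: "\<phi> (Y ?s \<xi>) = 0" "deriv \<phi> (Y ?s \<xi>) = 0" if "\<xi> \<notin> K'" for \<xi>
  proof -
    have "Y ?s \<xi> \<notin> closure {x. \<phi> x \<noteq> 0}" using that unfolding K'_def by (metis X_Y image_eqI)
    then show "\<phi> (Y ?s \<xi>) = 0" "deriv \<phi> (Y ?s \<xi>) = 0"
      using d(3) closure_subset[of "{x. \<phi> x \<noteq> 0}"] by auto
  qed
  have c\<phi>: "continuous_on S (\<lambda>x. \<phi> (f x))" "continuous_on S (\<lambda>x. deriv \<phi> (f x))" if "continuous_on S f"
    for S and f :: "real \<Rightarrow> real"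
    using that by (auto intro: continuous_on_compose2[OF smooth_continuous[OF sm]] continuous_on_compose2[OF d(2)])
  define D1 D2 where "D1 \<xi> = 2 * A ?s \<xi> * B ?s \<xi> * \<phi> (Y ?s \<xi>)"
    and "D2 \<xi> = deriv \<phi> (Y ?s \<xi>) * (A ?s \<xi>)\<^sup>2 * W ?s \<xi>" for \<xi>
  have cD: "continuous_on UNIV D1" "continuous_on UNIV D2"
    unfolding D1_def D2_def by (intro cont2 c\<phi> continuous_intros)+
  have iD: "integrable lborel D1" "integrable lborel D2"
    by (rule integrable_compact_support[OF _ K'], rule cD, simp add: D1_def D2_def out)+
  have "(\<integral>\<xi>. D1 \<xi> + D2 \<xi> \<partial>lborel) = 0"
  proof (rule integral_deriv_compact_support[OF _ _ K'])
    show "((\<lambda>\<xi>. W ?s \<xi> * \<phi> (Y ?s \<xi>)) has_real_derivative D1 \<xi> + D2 \<xi>) (at \<xi>)" for \<xi>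
      unfolding D1_def D2_def by (rule DERIV_mult[OF W_deriv DERIV_chain2[OF d(1) Y_deriv]])
    show "continuous_on UNIV (\<lambda>\<xi>. D1 \<xi> + D2 \<xi>)" by (intro continuous_intros cD)
  qed (simp_all add: D1_def D2_def out)
  then have "(\<integral>\<xi>. D2 \<xi> \<partial>lborel) = - (\<integral>\<xi>. D1 \<xi> \<partial>lborel)"
    using iD by simp
  moreover have "(\<integral>x. u t x * deriv \<phi> x \<partial>lborel) = - (\<integral>\<xi>. D2 \<xi> \<partial>lborel)"
    by (subst integral_Y(1)[of _ ?s]) (simp_all add: D2_def[abs_def] mult_ac)
  moreover have "(\<integral>x. v t x * \<phi> x \<partial>lborel) = - (\<integral>\<xi>. D1 \<xi> \<partial>lborel)"
    by (subst integral_Y(1)[of _ ?s]) (simp_all add: D1_def[abs_def] A_sq_v flip: mult.assoc)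
  ultimately show "(\<integral>x. u t x * deriv \<phi> x \<partial>lborel) = - (\<integral>x. v t x * \<phi> x \<partial>lborel)"
    by simp
qed

lemma rB_P_v: "rB_P l (v t) x = press B (T - t) x"
proof -
  have "rB_P l (v t) x = (\<integral>\<eta>. (A (T - t) \<eta>)\<^sup>2 * (green l (x - Y (T - t) \<eta>) * ((v t (Y (T - t) \<eta>))\<^sup>2 / 2)) \<partial>lborel)"
    unfolding rB_P_def green_def by (rule integral_Y(1)) simp
  also have "\<dots> = press B (T - t) x"
    unfolding press_def
  proof (rule integral_cong_AE)
    show "AE \<eta> in lborel. (A (T - t) \<eta>)\<^sup>2 * (green l (x - Y (T - t) \<eta>) * ((v t (Y (T - t) \<eta>))\<^sup>2 / 2))
       = kern B (T - t) x \<eta>"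
      using AE_lborel_singleton[of 0]
    proof eventually_elim
      case (elim \<eta>)
      have "(A (T - t) \<eta>)\<^sup>2 * (green l (x - Y (T - t) \<eta>) * ((v t (Y (T - t) \<eta>))\<^sup>2 / 2))
         = green l (x - Y (T - t) \<eta>) * ((A (T - t) \<eta>)\<^sup>2 * (v t (Y (T - t) \<eta>))\<^sup>2 / 2)" by simp
      also have "\<dots> = kern B (T - t) x \<eta>"
        unfolding A_sq_v_sq[OF elim] by (simp add: green_def kern_def)
      finally show ?case .
    qed
    show "(\<lambda>\<eta>. (A (T - t) \<eta>)\<^sup>2 * (green l (x - Y (T - t) \<eta>) * ((v t (Y (T - t) \<eta>))\<^sup>2 / 2))) \<in> borel_measurable lborel"
      unfolding green_def by measurable
  qed (use kern_measurable[OF adm] in simp)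
  finally show ?thesis .
qed

lemma v_in_Linf_L2_loc: "v \<in> Linf_L2_loc T"
  unfolding Linf_L2_loc_def
proof (intro CollectI conjI allI impI jointly_measurable_v)
  have i: "set_integrable lborel K (\<lambda>x. (v t x)\<^sup>2)" if "compact K" for K t
    unfolding set_integrable_def by (intro integrable_mult_indicator v_sq_integrable) (use that in \<open>auto intro: borel_compact\<close>)
  then show "AE t\<in>{0..T} in lborel. v t \<in> L2_loc"
    by (auto simp: L2_loc_def)
  fix K :: "real set" assume K: "compact K"
  have "L2_norm_on K (v t) \<le> sqrt (4 * (M\<^sup>2 * mass))" for t
  proof -
    have "(\<integral>x\<in>K. (v t x)\<^sup>2 \<partial>lborel) \<le> (\<integral>x. (v t x)\<^sup>2 \<partial>lborel)"
      unfolding set_lebesgue_integral_def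
      by (intro integral_mono i[OF K, unfolded set_integrable_def] v_sq_integrable) (auto split: split_indicator)
    also have "\<dots> \<le> 4 * (M\<^sup>2 * mass)" using B_sq_integral by (simp add: v_sq_integral)
    finally show ?thesis by (simp add: L2_norm_on_def)
  qed
  then show "\<exists>C. AE t\<in>{0..T} in lborel. L2_norm_on K (v t) \<le> C" by auto
qed

text \<open>Cauchy--Schwarz: \<open>(c A - 2 B)\<^sup>2\<close> is nonnegative for every constant \<open>c\<close>.\<close>

lemma W_diff_sq:
  assumes "a \<le> b"
  shows "ennreal ((W s b - W s a)\<^sup>2) \<le>
    ennreal (Y s b - Y s a) * (\<integral>\<^sup>+\<zeta>. ennreal (4 * (B s \<zeta>)\<^sup>2) * indicator {a..b} \<zeta> \<partial>lborel)"
proof (cases "a = b")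
  case False
  define Q where "Q = prim (\<lambda>\<zeta>. 4 * (B s \<zeta>)\<^sup>2)"
  have Q': "(Q has_real_derivative 4 * (B s \<zeta>)\<^sup>2) (at \<zeta>)" for \<zeta>
    unfolding Q_def by (rule has_real_derivative_prim) (intro cont continuous_intros)
  have Y: "Y s b - Y s a > 0" using Y_less[of a b s] assms False by simp
  define c where "c = (W s b - W s a) / (Y s b - Y s a)"
  have "c\<^sup>2 * Y s a - 2 * c * W s a + Q a \<le> c\<^sup>2 * Y s b - 2 * c * W s b + Q b"
  proof (rule DERIV_nonneg_imp_nondecreasing[OF assms], intro exI conjI)
    show "((\<lambda>x. c\<^sup>2 * Y s x - 2 * c * W s x + Q x) has_real_derivative (c * A s x - 2 * B s x)\<^sup>2) (at x)" for x
      by (auto intro!: derivative_eq_intros Y_deriv W_deriv Q' simp: power2_eq_square algebra_simps)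
  qed simp
  then have "2 * c * (W s b - W s a) - c\<^sup>2 * (Y s b - Y s a) \<le> Q b - Q a"
    by (simp add: algebra_simps)
  moreover have "2 * c * (W s b - W s a) - c\<^sup>2 * (Y s b - Y s a) = (W s b - W s a)\<^sup>2 / (Y s b - Y s a)"
    using Y by (simp add: c_def power2_eq_square)
  ultimately have "(W s b - W s a)\<^sup>2 / (Y s b - Y s a) \<le> Q b - Q a"
    by simp
  then have "(W s b - W s a)\<^sup>2 \<le> (Y s b - Y s a) * (Q b - Q a)"
    using Y by (simp only: pos_divide_le_eq mult.commute)
  moreover have "(\<integral>\<^sup>+\<zeta>. ennreal (4 * (B s \<zeta>)\<^sup>2) * indicator {a..b} \<zeta> \<partial>lborel) = ennreal (Q b - Q a)"
    by (rule nn_integral_FTC_Icc) (use assms Q' in auto)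
  ultimately show ?thesis using Y by (simp add: ennreal_leI flip: ennreal_mult')
qed simp

text \<open>The interval between \<xi> and the label of \<open>x\<close> is mapped into the ball of
  radius \<open>h\<close> about \<open>x\<close>, so the energy over that interval in
  \<open>W_diff_sq\<close> is at most the energy over the preimage of the ball.\<close>

lemma W_shift_sq:
  assumes "\<bar>Y s \<xi> - x\<bar> \<le> h"
  shows "ennreal ((W s \<xi> - W s (X s x))\<^sup>2) \<le>
    ennreal h * (\<integral>\<^sup>+\<zeta>. ennreal (4 * (B s \<zeta>)\<^sup>2) * (if \<bar>Y s \<zeta> - x\<bar> \<le> h then 1 else 0) \<partial>lborel)"
proof -
  have *: "ennreal ((W s b - W s a)\<^sup>2) \<le>
    ennreal h * (\<integral>\<^sup>+\<zeta>. ennreal (4 * (B s \<zeta>)\<^sup>2) * (if \<bar>Y s \<zeta> - x\<bar> \<le> h then 1 else 0) \<partial>lborel)"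
    if "a \<le> b" "\<bar>Y s a - x\<bar> \<le> h" "\<bar>Y s b - x\<bar> \<le> h" "Y s a = x \<or> Y s b = x" for a b
  proof (rule order_trans[OF W_diff_sq[OF that(1)]], intro mult_mono nn_integral_mono ennreal_leI)
    show "Y s b - Y s a \<le> h" using that by auto
    fix \<zeta>
    show "indicator {a..b} \<zeta> \<le> (if \<bar>Y s \<zeta> - x\<bar> \<le> h then 1 else 0 :: ennreal)"
      using pos_mono[OF adm, of a \<zeta> s] pos_mono[OF adm, of \<zeta> b s] that by (auto split: split_indicator)
  qed auto
  show ?thesis
    using *[of \<xi> "X s x"] *[of "X s x" \<xi>] assms
    by (cases "\<xi> \<le> X s x") (auto simp: power2_commute)
qed

text \<open>Tonelli: each label lies within distance \<open>h\<close> of a set of points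
  \<open>x\<close> of length \<open>2 * h\<close>. The factor \<open>h\<close> gained here joins the
  one in \<open>W_shift_sq\<close> to give the square needed for a Lipschitz bound in L2.\<close>

lemma shift_integral:
  assumes "h \<ge> 0"
  shows "(\<integral>\<^sup>+x. \<integral>\<^sup>+\<zeta>. ennreal (4 * (B s \<zeta>)\<^sup>2) * (if \<bar>Y s \<zeta> - x\<bar> \<le> h then 1 else 0) \<partial>lborel \<partial>lborel)
    \<le> ennreal (8 * h * (M\<^sup>2 * mass))"
proof -
  have "(\<integral>\<^sup>+x. \<integral>\<^sup>+\<zeta>. ennreal (4 * (B s \<zeta>)\<^sup>2) * (if \<bar>Y s \<zeta> - x\<bar> \<le> h then 1 else 0) \<partial>lborel \<partial>lborel)
     = (\<integral>\<^sup>+\<zeta>. \<integral>\<^sup>+x. ennreal (4 * (B s \<zeta>)\<^sup>2) * (if \<bar>Y s \<zeta> - x\<bar> \<le> h then 1 else 0) \<partial>lborel \<partial>lborel)"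
    by (rule lborel_pair.Fubini') measurable
  also have "\<dots> = (\<integral>\<^sup>+\<zeta>. ennreal (8 * h) * ennreal ((B s \<zeta>)\<^sup>2) \<partial>lborel)"
  proof (rule nn_integral_cong)
    fix \<zeta>
    have "(\<integral>\<^sup>+x. (if \<bar>Y s \<zeta> - x\<bar> \<le> h then 1 else 0) \<partial>lborel)
       = (\<integral>\<^sup>+x. indicator {Y s \<zeta> - h..Y s \<zeta> + h} x \<partial>lborel)"
      by (intro nn_integral_cong) (auto split: split_indicator)
    also have "\<dots> = ennreal (2 * h)" using assms by simp
    finally show "(\<integral>\<^sup>+x. ennreal (4 * (B s \<zeta>)\<^sup>2) * (if \<bar>Y s \<zeta> - x\<bar> \<le> h then 1 else 0) \<partial>lborel)
        = ennreal (8 * h) * ennreal ((B s \<zeta>)\<^sup>2)"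
      using assms by (subst nn_integral_cmult) (auto simp: mult_ac simp flip: ennreal_mult')
  qed
  also have "\<dots> = ennreal (8 * h) * ennreal (\<integral>\<zeta>. (B s \<zeta>)\<^sup>2 \<partial>lborel)"
    by (subst nn_integral_cmult) (auto simp: nn_integral_eq_integral[OF B_sq_integrable])
  also have "\<dots> \<le> ennreal (8 * h) * ennreal (M\<^sup>2 * mass)"
    by (intro mult_left_mono ennreal_leI B_sq_integral) auto
  finally show ?thesis using assms by (simp flip: ennreal_mult')
qed

text \<open>At a fixed \<open>x\<close> the velocity changes in two ways: along a fixed label, by
  \<open>W_Lipschitz\<close>, and because the label at \<open>x\<close> changes, by
  \<open>W_shift_sq\<close> with \<open>h\<close> the distance travelled. The second part is
  controlled by the energy, uniformly up to the singular time.\<close>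

lemma u_in_Lip_L2_loc: "u \<in> Lip_L2_loc T"
  unfolding Lip_L2_loc_def
proof (intro CollectI conjI allI ballI impI jointly_measurable_u)
  have cu: "continuous_on S (u t)" for S t
    by (intro continuous_on_Pair_compose[OF u_cont] continuous_intros)
  show "u t \<in> L2_loc" for t
    by (auto simp: L2_loc_def intro!: continuous_set_integrable continuous_intros cu)
  fix K :: "real set" assume K: "compact K"
  obtain N where N: "N \<ge> 0" "\<And>s \<xi>. \<bar>W s \<xi>\<bar> \<le> N * rho l \<xi>" using W_decay by blast
  have N': "\<bar>W s \<xi>\<bar> \<le> N" for s \<xi>
    using N(2)[of s \<xi>] mult_left_mono[OF rho_le_1[OF l, of \<xi>] N(1)] by simp
  have fin: "emeasure lborel K < \<infinity>" using emeasure_lborel_cbox_finite K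
    by (metis emeasure_compact_finite infinity_ennreal_def)
  define V where "V = measure lborel K"
  have sq: "(a + b)\<^sup>2 \<le> 2 * a\<^sup>2 + 2 * b\<^sup>2" for a b :: real
    using zero_le_power2[of "a - b"] by (simp add: power2_eq_square algebra_simps)
  \<comment> \<open>Both terms carry the 2 from \<open>sq\<close>; the 16 is this 2 times the 8 of
    \<open>shift_integral\<close>, taken at \<open>h = N * d\<close>.\<close>
  define C where "C = 2 * (l * C1)\<^sup>2 * V + 16 * N\<^sup>2 * (M\<^sup>2 * mass)"
  have C: "C \<ge> 0" using mass_nonneg by (simp add: C_def V_def)
  have "L2_norm_on K (\<lambda>x. u t x - u s x) \<le> sqrt C * \<bar>t - s\<bar>" if st: "s \<in> {0..T}" "t \<in> {0..T}" for s t
  proof -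
    define d where "d = \<bar>t - s\<bar>"
    define q where "q x = (\<integral>\<^sup>+\<zeta>. ennreal (4 * (B (T - s) \<zeta>)\<^sup>2) * (if \<bar>Y (T - s) \<zeta> - x\<bar> \<le> N * d then 1 else 0) \<partial>lborel)" for x
    have [measurable]: "q \<in> borel_measurable borel" unfolding q_def by measurable
    have d: "d \<ge> 0" by (simp add: d_def)
    have pt: "ennreal ((u t x - u s x)\<^sup>2) \<le> ennreal (2 * (l * C1 * d)\<^sup>2) + ennreal (2 * (N * d)) * q x" for x
    proof -
      define \<xi> \<eta> where "\<xi> = X (T - t) x" and "\<eta> = X (T - s) x"
      have ts: "T - s \<in> {0..T}" "T - t \<in> {0..T}" using st by auto
      have "\<bar>Y (T - s) \<xi> - Y (T - t) \<xi>\<bar> \<le> N * \<bar>(T - s) - (T - t)\<bar>"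
        by (rule interior_derivative_bound[OF _ Y_deriv_time N' ts]) (intro cont2 continuous_intros)
      then have "\<bar>Y (T - s) \<xi> - x\<bar> \<le> N * d" by (simp add: \<xi>_def d_def)
      from W_shift_sq[OF this] have 2: "ennreal ((W (T - s) \<xi> - W (T - s) \<eta>)\<^sup>2) \<le> ennreal (N * d) * q x"
        by (simp add: q_def \<eta>_def)
      have "\<bar>W (T - t) \<xi> - W (T - s) \<xi>\<bar> \<le> l * C1 * rho l \<xi> * \<bar>(T - t) - (T - s)\<bar>"
        by (rule W_Lipschitz) (use ts in auto)
      also have "\<dots> = (l * C1 * d) * rho l \<xi>" by (simp add: d_def abs_minus_commute mult_ac)
      also have "\<dots> \<le> (l * C1 * d) * 1"
        using l C_nonneg d by (intro mult_left_mono rho_le_1) auto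
      finally have "\<bar>W (T - t) \<xi> - W (T - s) \<xi>\<bar>\<^sup>2 \<le> (l * C1 * d)\<^sup>2"
        by (intro power_mono) auto
      then have 1: "(W (T - t) \<xi> - W (T - s) \<xi>)\<^sup>2 \<le> (l * C1 * d)\<^sup>2" by simp
      have "(u t x - u s x)\<^sup>2 = ((W (T - t) \<xi> - W (T - s) \<xi>) + (W (T - s) \<xi> - W (T - s) \<eta>))\<^sup>2"
        by (simp add: u_def \<xi>_def \<eta>_def power2_commute)
      also have "\<dots> \<le> 2 * (W (T - t) \<xi> - W (T - s) \<xi>)\<^sup>2 + 2 * (W (T - s) \<xi> - W (T - s) \<eta>)\<^sup>2"
        by (rule sq)
      also have "\<dots> \<le> 2 * (l * C1 * d)\<^sup>2 + 2 * (W (T - s) \<xi> - W (T - s) \<eta>)\<^sup>2"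
        using 1 by simp
      finally have "ennreal ((u t x - u s x)\<^sup>2) \<le> ennreal (2 * (l * C1 * d)\<^sup>2 + 2 * (W (T - s) \<xi> - W (T - s) \<eta>)\<^sup>2)"
        by (rule ennreal_leI)
      also have "\<dots> = ennreal (2 * (l * C1 * d)\<^sup>2) + 2 * ennreal ((W (T - s) \<xi> - W (T - s) \<eta>)\<^sup>2)"
        by (simp add: ennreal_plus ennreal_mult')
      also have "\<dots> \<le> ennreal (2 * (l * C1 * d)\<^sup>2) + 2 * (ennreal (N * d) * q x)"
        by (intro add_mono mult_left_mono 2) auto
      finally show ?thesis using N d by (simp add: ennreal_mult' mult.assoc)
    qed
    have "(\<integral>\<^sup>+x. ennreal (indicator K x * (u t x - u s x)\<^sup>2) \<partial>lborel)
      \<le> (\<integral>\<^sup>+x. ennreal (2 * (l * C1 * d)\<^sup>2) * indicator K x + ennreal (2 * (N * d)) * q x \<partial>lborel)"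
      by (intro nn_integral_mono) (use pt in \<open>auto split: split_indicator\<close>)
    also have "\<dots> = ennreal (2 * (l * C1 * d)\<^sup>2) * emeasure lborel K + ennreal (2 * (N * d)) * (\<integral>\<^sup>+x. q x \<partial>lborel)"
      using borel_compact[OF K]
      by (subst nn_integral_add) (auto simp: nn_integral_cmult nn_integral_cmult_indicator)
    also have "\<dots> \<le> ennreal (2 * (l * C1 * d)\<^sup>2) * ennreal V + ennreal (2 * (N * d)) * ennreal (8 * (N * d) * (M\<^sup>2 * mass))"
    proof (intro add_mono mult_left_mono)
      show "emeasure lborel K \<le> ennreal V"
        using fin by (simp add: V_def emeasure_eq_ennreal_measure less_top)
      show "(\<integral>\<^sup>+x. q x \<partial>lborel) \<le> ennreal (8 * (N * d) * (M\<^sup>2 * mass))"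
        unfolding q_def using N d by (intro shift_integral) auto
    qed auto
    also have "\<dots> = ennreal (C * d\<^sup>2)"
    proof -
      have "2 * (l * C1 * d)\<^sup>2 * V + 2 * (N * d) * (8 * (N * d) * (M\<^sup>2 * mass)) = C * d\<^sup>2"
        by (simp add: C_def power2_eq_square algebra_simps)
      then show ?thesis
        using N d mass_nonneg by (simp add: V_def flip: ennreal_mult ennreal_plus)
    qed
    finally have "(\<integral>x. indicator K x * (u t x - u s x)\<^sup>2 \<partial>lborel) \<le> C * d\<^sup>2"
      using C by (intro integral_real_bounded) auto
    then have "L2_norm_on K (\<lambda>x. u t x - u s x) \<le> sqrt (C * d\<^sup>2)"
      by (simp add: L2_norm_on_def set_lebesgue_integral_def)
    then show ?thesis by (simp add: real_sqrt_mult d_def)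
  qed
  then show "\<exists>C. \<forall>s\<in>{0..T}. \<forall>t\<in>{0..T}. L2_norm_on K (\<lambda>x. u t x - u s x) \<le> C * \<bar>t - s\<bar>"
    by blast
qed

text \<open>Pulled back to the coordinates \<open>(t, \<xi>)\<close>, the integrand of the weak equation is a compactly
  supported divergence \<open>\<partial>G2 / \<partial>\<xi> - \<partial>G1 / \<partial>t\<close> whose terms are continuous even where \<open>v\<close> is not.\<close>

lemma weak_equation: "rB_weak_equation l T u v"
  unfolding rB_weak_equation_def
proof (intro conjI allI impI)
  show "AE t\<in>{0..T} in lborel. \<forall>x. integrable lborel (\<lambda>y. green l (x - y) * ((v t y)\<^sup>2 / 2))"
  proof (intro AE_I2 impI allI)
    fix t x
    show "integrable lborel (\<lambda>y. green l (x - y) * ((v t y)\<^sup>2 / 2))"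
    proof (rule Bochner_Integration.integrable_bound[OF integrable_mult_right[OF v_sq_integrable[of t], of "1 / (4 * l)"]])
      show "AE y in lborel. norm (green l (x - y) * ((v t y)\<^sup>2 / 2)) \<le> norm (1 / (4 * l) * (v t y)\<^sup>2)"
      proof (rule AE_I2)
        fix y
        have "0 \<le> green l (x - y)" "green l (x - y) \<le> 1 / (2 * l)"
          using l by (auto simp: green_def field_simps)
        then have "green l (x - y) * ((v t y)\<^sup>2 / 2) \<le> 1 / (2 * l) * ((v t y)\<^sup>2 / 2)"
          by (intro mult_right_mono) auto
        then show "norm (green l (x - y) * ((v t y)\<^sup>2 / 2)) \<le> norm (1 / (4 * l) * (v t y)\<^sup>2)"
          using l \<open>0 \<le> green l (x - y)\<close> by simp
      qed
    qed (simp add: green_def)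
  qed
  have cp: "continuous_on UNIV (\<lambda>(t, x). rB_P l (v t) x)"
    unfolding rB_P_v split_beta by (intro cont2 continuous_intros)
  show "loc_integrable_on ({0<..<T} \<times> UNIV) (\<lambda>(t, x). rB_P l (v t) x)"
    unfolding loc_integrable_on_def by (intro allI impI continuous_set_integrable cp) auto
  fix \<phi> :: "real \<times> real \<Rightarrow> real" assume "test_function_on ({0<..<T} \<times> UNIV) \<phi>"
  then have sm: "smooth \<phi>" and K: "compact (closure {x. \<phi> x \<noteq> 0})"
    and sub: "closure {x. \<phi> x \<noteq> 0} \<subseteq> {0<..<T} \<times> UNIV"
    by (auto simp: test_function_on_def)
  let ?S = "closure {x. \<phi> x \<noteq> 0}"
  define \<phi>t \<phi>x where "\<phi>t p = frechet_derivative \<phi> (at p) (1, 0)"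
    and "\<phi>x p = frechet_derivative \<phi> (at p) (0, 1)" for p
  have chain: "((\<lambda>t. \<phi> (a t, b t)) has_real_derivative a' * \<phi>t (a t, b t) + b' * \<phi>x (a t, b t)) (at t)"
    if "(a has_real_derivative a') (at t)" "(b has_real_derivative b') (at t)" for a b a' b' t
    unfolding \<phi>t_def \<phi>x_def by (rule smooth_chain[OF sm that])
  have dt: "deriv (\<lambda>s. \<phi> (s, x)) t = \<phi>t (t, x)" for t x
    using DERIV_imp_deriv[OF chain[OF DERIV_ident DERIV_const, of x t]] by simp
  have dx: "deriv (\<lambda>y. \<phi> (t, y)) x = \<phi>x (t, x)" for t x
    using DERIV_imp_deriv[OF chain[OF DERIV_const DERIV_ident, of t x]] by simp
  have c0: "continuous_on UNIV \<phi>" "continuous_on UNIV \<phi>t" "continuous_on UNIV \<phi>x"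
    unfolding \<phi>t_def \<phi>x_def by (intro smooth_continuous smooth_frechet sm)+
  have c\<phi>: "continuous_on Z (\<lambda>x. \<phi> (f x, g x))" "continuous_on Z (\<lambda>x. \<phi>t (f x, g x))"
      "continuous_on Z (\<lambda>x. \<phi>x (f x, g x))"
    if "continuous_on Z f" "continuous_on Z g" for Z :: "(real \<times> real) set" and f g :: "real \<times> real \<Rightarrow> real"
    using that by (auto intro!: continuous_on_compose2[OF c0(1)] continuous_on_compose2[OF c0(2)]
        continuous_on_compose2[OF c0(3)] continuous_intros)
  have out0: "\<phi> p = 0" "\<phi>t p = 0" "\<phi>x p = 0" if "p \<notin> ?S" for p
    using that closure_subset[of "{x. \<phi> x \<noteq> 0}"] frechet_derivative_outside_support[OF that]
    by (auto simp: \<phi>t_def \<phi>x_def)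
  define K' where "K' = (\<lambda>(t, x). (t, X (T - t) x)) ` ?S"
  have K': "compact K'"
    unfolding K'_def split_beta by (intro compact_continuous_image K cont2 continuous_intros)
  have notin: "(t, Y (T - t) \<xi>) \<notin> ?S" if "(t, \<xi>) \<notin> K'" for t \<xi>
    using that unfolding K'_def by (force intro: rev_image_eqI)
  note out = out0[OF notin]
  define G1 where "G1 t \<xi> = - W (T - t) \<xi> * \<phi> (t, Y (T - t) \<xi>) * (A (T - t) \<xi>)\<^sup>2" for t \<xi>
  define D1 where "D1 t \<xi> = - l * R (T - t) \<xi> * \<phi> (t, Y (T - t) \<xi>) * (A (T - t) \<xi>)\<^sup>2
      - W (T - t) \<xi> * (\<phi>t (t, Y (T - t) \<xi>) - W (T - t) \<xi> * \<phi>x (t, Y (T - t) \<xi>)) * (A (T - t) \<xi>)\<^sup>2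
      + 2 * W (T - t) \<xi> * \<phi> (t, Y (T - t) \<xi>) * A (T - t) \<xi> * B (T - t) \<xi>" for t \<xi>
  \<comment> \<open>The term \<open>W^2\<close> compensates the motion of the coordinates:
    differentiating \<phi> along the flow produces \<open>- W \<phi>x\<close>, and the resulting
    \<open>W^2 \<phi>x A^2\<close> cancels in \<open>D2 - D1\<close>.\<close>
  define G2 where "G2 t \<xi> = ((W (T - t) \<xi>)\<^sup>2 - l\<^sup>2 * P (T - t) \<xi>) * \<phi> (t, Y (T - t) \<xi>)" for t \<xi>
  define D2 where "D2 t \<xi> = (4 * W (T - t) \<xi> * A (T - t) \<xi> * B (T - t) \<xi> - l * (A (T - t) \<xi>)\<^sup>2 * R (T - t) \<xi>) * \<phi> (t, Y (T - t) \<xi>)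
      + ((W (T - t) \<xi>)\<^sup>2 - l\<^sup>2 * P (T - t) \<xi>) * (\<phi>x (t, Y (T - t) \<xi>) * (A (T - t) \<xi>)\<^sup>2)" for t \<xi>
  have D1_cont: "continuous_on UNIV (\<lambda>(t, \<xi>). D1 t \<xi>)" and D2_cont: "continuous_on UNIV (\<lambda>(t, \<xi>). D2 t \<xi>)"
    unfolding D1_def D2_def split_beta by (intro cont2 c\<phi> continuous_intros)+
  have D1_out: "D1 t \<xi> = 0" "G1 t \<xi> = 0" and D2_out: "D2 t \<xi> = 0" "G2 t \<xi> = 0" if "(t, \<xi>) \<notin> K'" for t \<xi>
    by (simp_all add: D1_def D2_def G1_def G2_def out[OF that])
  have D1_deriv: "((\<lambda>t. G1 t \<xi>) has_real_derivative D1 t \<xi>) (at t)" for t \<xi>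
  proof (cases "0 < t \<and> t < T")
    case True
    then have s: "0 < T - t" "T - t < T" by auto
    have flip: "((\<lambda>t. f (T - t)) has_real_derivative - f') (at t)"
      if "(f has_real_derivative f') (at (T - t))" for f f'
      using DERIV_chain2[OF that DERIV_diff[OF DERIV_const DERIV_ident]] by simp
    note W' = flip[OF W_deriv_time[OF s, of \<xi>]] and A' = flip[OF A_deriv[OF s, of \<xi>]]
      and \<phi>' = chain[OF DERIV_ident flip[OF Y_deriv_time[OF s, of \<xi>]]]
    show ?thesis
      unfolding G1_def
      by (rule DERIV_cong[OF DERIV_mult[OF DERIV_mult[OF DERIV_minus[OF W'] \<phi>'] DERIV_power[OF A']]])
        (simp add: D1_def algebra_simps power2_eq_square)
  next
    \<comment> \<open>The clamped flow need not be differentiable at these times, but the support of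
      \<phi> lies inside the open strip, so \<open>G1\<close> vanishes near
      \<open>t\<close>.\<close>
    case False
    define Z where "Z = (\<lambda>t. (t, Y (T - t) \<xi>)) -` (- ?S)"
    have open_Z: "open Z" unfolding Z_def
      by (intro open_vimage continuous_intros cont2) auto
    have t_Z: "t \<in> Z" using False sub by (auto simp: Z_def)
    have zero: "G1 t' \<xi> = 0" if "t' \<in> Z" for t'
    proof -
      have "(t', Y (T - t') \<xi>) \<notin> ?S" using that unfolding Z_def by blast
      from out0(1)[OF this] show ?thesis by (simp add: G1_def)
    qed
    have "((\<lambda>t. G1 t \<xi>) has_real_derivative 0) (at t)"
      by (rule has_field_derivative_transform_within_open[OF DERIV_const open_Z t_Z]) (simp only: zero)
    moreover have "D1 t \<xi> = 0"
    proof -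
      have "(t, Y (T - t) \<xi>) \<notin> ?S" using t_Z unfolding Z_def by blast
      from out0[OF this] show ?thesis by (simp add: D1_def)
    qed
    ultimately show ?thesis by simp
  qed
  have D2_deriv: "((\<lambda>\<xi>. G2 t \<xi>) has_real_derivative D2 t \<xi>) (at \<xi>)" for t \<xi>
    unfolding G2_def
    by (rule DERIV_cong[OF DERIV_mult[OF DERIV_diff[OF DERIV_power[OF W_deriv] DERIV_cmult[OF P_deriv]]
          chain[OF DERIV_const Y_deriv]]])
      (use l in \<open>simp add: D2_def field_simps power2_eq_square\<close>)
  define F where "F t x = - u t x * deriv (\<lambda>s. \<phi> (s, x)) t + u t x * v t x * \<phi> (t, x)
      - l\<^sup>2 * rB_P l (v t) x * deriv (\<lambda>y. \<phi> (t, y)) x" for t x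
  \<comment> \<open>The Jacobian multiplies \<open>v\<close>, and \<open>A_sq_v\<close> replaces the
    product by a continuous function.\<close>
  have F_D: "(A (T - t) \<xi>)\<^sup>2 * F t (Y (T - t) \<xi>) = D2 t \<xi> - D1 t \<xi>" for t \<xi>
  proof -
    have "(A (T - t) \<xi>)\<^sup>2 * F t (Y (T - t) \<xi>) = (A (T - t) \<xi>)\<^sup>2 * W (T - t) \<xi> * \<phi>t (t, Y (T - t) \<xi>)
       - W (T - t) \<xi> * ((A (T - t) \<xi>)\<^sup>2 * v t (Y (T - t) \<xi>)) * \<phi> (t, Y (T - t) \<xi>)
       - l\<^sup>2 * P (T - t) \<xi> * ((A (T - t) \<xi>)\<^sup>2 * \<phi>x (t, Y (T - t) \<xi>))"
      by (simp add: F_def dt dx rB_P_v algebra_simps)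
    also have "\<dots> = D2 t \<xi> - D1 t \<xi>"
      unfolding A_sq_v by (simp add: D1_def D2_def algebra_simps power2_eq_square)
    finally show ?thesis .
  qed
  have F_meas [measurable]: "(\<lambda>(t, x). F t x) \<in> borel_measurable borel"
  proof -
    have 1: "(\<lambda>p. u (fst p) (snd p)) \<in> borel_measurable borel" "(\<lambda>p. rB_P l (v (fst p)) (snd p)) \<in> borel_measurable borel"
      using borel_measurable_continuous_onI[OF u_cont] borel_measurable_continuous_onI[OF cp] by (simp_all add: case_prod_beta')
    have 2: "(\<lambda>p. v (fst p) (snd p)) \<in> borel_measurable borel" using v_joint by (simp add: case_prod_beta')
    have 3: "\<phi> \<in> borel_measurable borel" "\<phi>t \<in> borel_measurable borel" "\<phi>x \<in> borel_measurable borel"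
      using c0 by (auto intro: borel_measurable_continuous_onI)
    show ?thesis
      unfolding F_def split_beta dt dx prod.collapse
      by (intro borel_measurable_diff borel_measurable_add borel_measurable_times borel_measurable_uminus
          1 2 3 borel_measurable_const)
  qed
  have mA: "(\<lambda>(t, \<xi>). (A (T - t) \<xi>)\<^sup>2) \<in> borel_measurable borel"
    unfolding split_beta by (intro borel_measurable_continuous_onI cont2 continuous_intros)
  have mY: "(\<lambda>(t, \<xi>). (t, Y (T - t) \<xi>)) \<in> borel \<rightarrow>\<^sub>M borel"
    unfolding split_beta by (intro borel_measurable_continuous_onI cont2 continuous_intros)
  have "integral\<^sup>L lborel (\<lambda>(t, x). F t x)
     = (\<integral>p. (case p of (t, \<xi>) \<Rightarrow> F t (Y (T - t) \<xi>)) \<partial>density lborel (\<lambda>(t, \<xi>). ennreal ((A (T - t) \<xi>)\<^sup>2)))"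
    by (subst distr_Y_time[symmetric], subst integral_distr)
      (use mY F_meas in \<open>auto simp: case_prod_beta'\<close>)
  also have "\<dots> = (\<integral>p. (case p of (t, \<xi>) \<Rightarrow> D2 t \<xi> - D1 t \<xi>) \<partial>lborel)"
    using integral_real_density[of "\<lambda>(t, \<xi>). (A (T - t) \<xi>)\<^sup>2" lborel "\<lambda>(t, \<xi>). F t (Y (T - t) \<xi>)"]
      mA measurable_compose[OF mY F_meas] by (simp add: case_prod_beta' F_D)
  also have "\<dots> = (\<integral>p. (case p of (t, \<xi>) \<Rightarrow> D2 t \<xi>) \<partial>lborel) - (\<integral>p. (case p of (t, \<xi>) \<Rightarrow> D1 t \<xi>) \<partial>lborel)"
    unfolding split_beta
    by (rule Bochner_Integration.integral_diff)
      (rule integrable_compact_support[OF _ K'], use D1_cont D2_cont D1_out D2_out in \<open>auto simp: case_prod_beta'\<close>)+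
  also have "\<dots> = 0"
    using integral_partial_deriv1_compact_support[OF D1_deriv D1_cont K' D1_out(2,1)]
      integral_partial_deriv2_compact_support[OF D2_deriv D2_cont K' D2_out(2,1)] by simp
  finally show "integral\<^sup>L lborel (\<lambda>(t, x). - u t x * deriv (\<lambda>s. \<phi> (s, x)) t
            + u t x * v t x * \<phi> (t, x) - l\<^sup>2 * rB_P l (v t) x * deriv (\<lambda>y. \<phi> (t, y)) x) = 0"
    unfolding F_def .
qed

lemma solution: "rB_solution l T u"
  unfolding rB_solution_def
  using u_in_Lip_L2_loc v_in_Linf_L2_loc weak_deriv_u weak_equation by blast

section \<open>Regularity at the initial time, infinite weighted energy at the final time\<close>

lemma v_initial_bound: "\<bar>v 0 x\<bar> \<le> 4 * M / T"
proof -
  have a: "A T \<xi> \<ge> T / 2" for \<xi> using A_lower[of T \<xi>] T by simp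
  have "\<bar>v 0 x\<bar> = 2 * \<bar>B T (X T x)\<bar> / A T (X T x)"
    using a[of "X T x"] T by (simp add: v_def)
  also have "\<dots> \<le> 2 * M / (T / 2)"
    using a[of "X T x"] T b_le_M[OF adm] M by (intro frac_le mult_left_mono) auto
  finally show ?thesis by simp
qed

lemma initial_spaces: "u 0 \<in> H1 \<inter> W1inf"
proof -
  obtain N where N: "N \<ge> 0" "\<And>s \<xi>. \<bar>W s \<xi>\<bar> \<le> N * rho l \<xi>" using W_decay by blast
  have "integrable lborel (\<lambda>x. (u 0 x)\<^sup>2)"
  proof (subst integral_Y(2)[of _ T])
    show "integrable lborel (\<lambda>\<xi>. (A T \<xi>)\<^sup>2 * (u 0 (Y T \<xi>))\<^sup>2)"
    proof (rule Bochner_Integration.integrable_bound[OF integrable_mult_right[OF integrable_rho[OF l], of "(3 / 2)\<^sup>2 * N\<^sup>2"]])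
      show "AE \<xi> in lborel. norm ((A T \<xi>)\<^sup>2 * (u 0 (Y T \<xi>))\<^sup>2) \<le> norm ((3 / 2)\<^sup>2 * N\<^sup>2 * rho l \<xi>)"
      proof (rule AE_I2)
        fix \<xi>
        have "\<bar>A T \<xi>\<bar>\<^sup>2 \<le> (3 / 2)\<^sup>2" by (intro power_mono accum_bound adm) auto
        moreover have "\<bar>W T \<xi>\<bar>\<^sup>2 \<le> (N * rho l \<xi>)\<^sup>2" by (intro power_mono N) auto
        moreover have "(N * rho l \<xi>)\<^sup>2 \<le> N\<^sup>2 * rho l \<xi>"
          using mult_left_mono[OF rho_le_1[OF l, of \<xi>], of "rho l \<xi>"]
          unfolding power_mult_distrib by (intro mult_left_mono) (auto simp: power2_eq_square)
        ultimately have "(A T \<xi>)\<^sup>2 * (W T \<xi>)\<^sup>2 \<le> (3 / 2)\<^sup>2 * (N\<^sup>2 * rho l \<xi>)"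
          by (intro mult_mono) auto
        then show "norm ((A T \<xi>)\<^sup>2 * (u 0 (Y T \<xi>))\<^sup>2) \<le> norm ((3 / 2)\<^sup>2 * N\<^sup>2 * rho l \<xi>)"
          using u_Y[of 0 \<xi>] by (simp add: abs_mult mult.assoc)
      qed
    qed measurable
  qed simp
  then have 1: "u 0 \<in> L2" by (simp add: L2_def)
  have "\<bar>u 0 x\<bar> \<le> N" for x
    using N(2)[of T "X T x"] mult_left_mono[OF rho_le_1[OF l, of "X T x"] N(1)] by (simp add: u_def)
  then have 2: "u 0 \<in> Linf" unfolding Linf_def by auto
  have "v 0 \<in> L2" using v_sq_integrable by (simp add: L2_def)
  moreover have "v 0 \<in> Linf" unfolding Linf_def using v_initial_bound by auto
  ultimately show ?thesis using 1 2 weak_deriv_u unfolding H1_def W1inf_def by blast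
qed

lemma initial_weight_finite:
  assumes "\<delta> > 0"
  shows "(\<integral>\<^sup>+x. ennreal ((v 0 x)\<^sup>2 * log_weight \<delta> (v 0 x)) \<partial>lborel) < \<infinity>"
proof -
  define m where "m = 4 * M / T"
  define c where "c = \<delta> powr \<delta> + m * \<bar>ln m\<bar> powr \<delta>"
  have "(\<integral>\<^sup>+x. ennreal ((v 0 x)\<^sup>2 * log_weight \<delta> (v 0 x)) \<partial>lborel) \<le> (\<integral>\<^sup>+x. ennreal (c * \<bar>v 0 x\<bar>) \<partial>lborel)"
    unfolding c_def m_def by (intro nn_integral_mono ennreal_leI log_weight_bound assms v_initial_bound)
  also have "\<dots> = ennreal (\<integral>x. c * \<bar>v 0 x\<bar> \<partial>lborel)"
  proof (rule nn_integral_eq_integral)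
    have "c \<ge> 0" using M T by (simp add: c_def m_def)
    then show "AE x in lborel. 0 \<le> c * \<bar>v 0 x\<bar>" by simp
  qed (intro integrable_mult_right integrable_abs v_integrable)
  finally show ?thesis by (simp add: le_less_trans)
qed

text \<open>At \<open>s = 0\<close> and near the origin \<open>B = 1\<close>, so
  \<open>v = - 2 / A0\<close>. The Jacobian cancels \<open>1 / A0^2\<close>, and the weight alone
  remains, which is at least a multiple of \<open>1 / \<xi>\<close>.\<close>

lemma final_weight_infinite:
  assumes e: "0 < e" "e \<le> 1" and c: "c > 0"
    and le: "\<And>\<xi>. 0 < \<xi> \<Longrightarrow> \<xi> \<le> e \<Longrightarrow> c / \<xi> \<le> \<bar>ln (2 / A0 \<xi>)\<bar> powr \<delta>"
  shows "(\<integral>\<^sup>+x\<in>{0..Y 0 e}. ennreal ((v T x)\<^sup>2 * log_weight \<delta> (v T x)) \<partial>lborel) = \<infinity>"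
proof -
  have [measurable]: "(\<lambda>x. ennreal ((v T x)\<^sup>2 * log_weight \<delta> (v T x)) * indicator {0..Y 0 e} x) \<in> borel_measurable borel"
    unfolding log_weight_def by measurable
  have "\<infinity> = ennreal (4 * c) * (\<integral>\<^sup>+\<xi>. ennreal (1 / \<xi>) * indicator {0<..e} \<xi> \<partial>lborel)"
    using c by (simp add: nn_integral_inverse_infinite[OF e(1)] ennreal_mult_top)
  also have "\<dots> = (\<integral>\<^sup>+\<xi>. ennreal (4 * c) * (ennreal (1 / \<xi>) * indicator {0<..e} \<xi>) \<partial>lborel)"
    by (rule nn_integral_cmult[symmetric]) measurable
  also have "\<dots> \<le> (\<integral>\<^sup>+\<xi>. ennreal ((A 0 \<xi>)\<^sup>2) * (ennreal ((v T (Y 0 \<xi>))\<^sup>2 * log_weight \<delta> (v T (Y 0 \<xi>))) * indicator {0..Y 0 e} (Y 0 \<xi>)) \<partial>lborel)"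
  proof (rule nn_integral_mono)
    fix \<xi>
    show "ennreal (4 * c) * (ennreal (1 / \<xi>) * indicator {0<..e} \<xi>)
       \<le> ennreal ((A 0 \<xi>)\<^sup>2) * (ennreal ((v T (Y 0 \<xi>))\<^sup>2 * log_weight \<delta> (v T (Y 0 \<xi>))) * indicator {0..Y 0 e} (Y 0 \<xi>))"
    proof (cases "0 < \<xi> \<and> \<xi> \<le> e")
      case True
      then have \<xi>: "0 < \<xi>" "\<xi> \<le> e" "\<bar>\<xi>\<bar> \<le> 1" using e by auto
      have B: "B 0 \<xi> = 1" using B0_inner[OF \<xi>(3)] by (simp add: B_zero)
      have Ap: "A0 \<xi> > 0" using A0_pos[of \<xi>] \<xi> by simp
      have vv: "v T (Y 0 \<xi>) = - 2 / A0 \<xi>" using v_Y[of T \<xi>] B by (simp add: A_zero)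
      have i: "indicator {0..Y 0 e} (Y 0 \<xi>) = (1::ennreal)"
        using pos_mono[OF adm, of 0 \<xi> 0] pos_mono[OF adm, of \<xi> e 0] \<xi> by simp
      have "4 * c * (1 / \<xi>) \<le> 4 * \<bar>ln (2 / A0 \<xi>)\<bar> powr \<delta>" using le[of \<xi>] \<xi> by simp
      also have "\<dots> = (A 0 \<xi>)\<^sup>2 * ((v T (Y 0 \<xi>))\<^sup>2 * log_weight \<delta> (v T (Y 0 \<xi>)))"
        using Ap by (simp add: vv A_zero log_weight_def power_divide)
      finally have "ennreal (4 * c * (1 / \<xi>)) \<le> ennreal ((A 0 \<xi>)\<^sup>2 * ((v T (Y 0 \<xi>))\<^sup>2 * log_weight \<delta> (v T (Y 0 \<xi>))))"
        by (rule ennreal_leI)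
      then show ?thesis
        using c \<xi> by (simp only: i mult_1_right ennreal_mult' zero_le_power2) (simp add: ennreal_mult' i)
    qed (auto split: split_indicator)
  qed
  also have "\<dots> = (\<integral>\<^sup>+x\<in>{0..Y 0 e}. ennreal ((v T x)\<^sup>2 * log_weight \<delta> (v T x)) \<partial>lborel)"
    by (rule nn_integral_Y[symmetric]) measurable
  finally show ?thesis by (simp add: top_unique)
qed

end

subsection \<open>The data at the final time\<close>

text \<open>\<open>A0\<close>: since \<open>v = - 2 / A0\<close> near the origin and \<open>v\<^sup>2 dx = 4 d\<xi>\<close>, the weight is \<open>\<bar>ln (2 / A0)\<bar>\<close> to the
  power \<open>\<delta>\<close>, which has to behave like the non-integrable \<open>1 / \<xi>\<close>.\<close>

definition profile :: "real \<Rightarrow> real \<Rightarrow> real" where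
  "profile \<delta> \<xi> = (if \<xi> = 0 then 0 else min 1 (exp (1 - \<bar>\<xi>\<bar> powr (- (1 / \<delta>)))))"

lemma profile_even: "profile \<delta> (- \<xi>) = profile \<delta> \<xi>"
  by (simp add: profile_def)

lemma profile_bounds: "0 \<le> profile \<delta> \<xi>" "profile \<delta> \<xi> \<le> 1"
  by (simp_all add: profile_def)

lemma profile_pos: "\<xi> \<noteq> 0 \<Longrightarrow> profile \<delta> \<xi> > 0"
  by (simp add: profile_def)

text \<open>The summand 1 in the exponent of \<open>profile\<close> makes the exponential reach the
  value 1 exactly at \<open>|\<xi>| = 1\<close>; beyond, the minimum cuts it off.\<close>

lemma profile_outer:
  assumes \<delta>: "\<delta> > 0" and "\<bar>\<xi>\<bar> \<ge> 1"
  shows "profile \<delta> \<xi> = 1"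
proof -
  have "\<bar>\<xi>\<bar> powr (- (1 / \<delta>)) \<le> \<bar>\<xi>\<bar> powr 0"
    using assms \<delta> by (intro powr_mono) auto
  then show ?thesis using assms by (auto simp: profile_def)
qed

lemma profile_cont:
  assumes \<delta>: "\<delta> > 0"
  shows "continuous_on UNIV (profile \<delta>)"
  unfolding continuous_on_eq_continuous_at[OF open_UNIV]
proof
  fix x :: real
  show "isCont (profile \<delta>) x"
  proof (cases "x = 0")
    case False
    have "continuous_on (- {0}) (\<lambda>\<xi>::real. min 1 (exp (1 - \<bar>\<xi>\<bar> powr (- (1 / \<delta>)))))"
      by (intro continuous_intros) auto
    then have "continuous_on (- {0}) (profile \<delta>)"
      by (rule continuous_on_cong[THEN iffD1, rotated 2]) (auto simp: profile_def)
    then show ?thesis using False by (simp add: continuous_on_eq_continuous_at open_Compl)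
  next
    case True
    \<comment> \<open>A crude majorant from \<open>z \<le> exp z\<close>, enough to squeeze the
      profile to 0 at the origin.\<close>
    have le: "profile \<delta> \<xi> \<le> exp 1 * \<bar>\<xi>\<bar> powr (1 / \<delta>)" for \<xi>
    proof (cases "\<xi> = 0")
      case False
      define z where "z = \<bar>\<xi>\<bar> powr (- (1 / \<delta>))"
      have z: "z > 0" using False by (simp add: z_def)
      have "z \<le> exp z" using exp_ge_add_one_self[of z] by linarith
      then have "exp (1 - z) \<le> exp 1 / z"
        using z by (simp add: exp_diff field_simps)
      also have "exp 1 / z = exp 1 * \<bar>\<xi>\<bar> powr (1 / \<delta>)"
        by (simp add: z_def powr_minus_divide)
      finally show ?thesis using False by (simp add: profile_def z_def min_le_iff_disj)
    qed (simp add: profile_def)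
    have "((\<lambda>\<xi>. exp 1 * \<bar>\<xi>\<bar> powr (1 / \<delta>)) \<longlongrightarrow> exp 1 * \<bar>0\<bar> powr (1 / \<delta>)) (at 0)"
      using \<delta> by (intro tendsto_intros tendsto_powr') auto
    then have "((\<lambda>\<xi>. exp 1 * \<bar>\<xi>\<bar> powr (1 / \<delta>)) \<longlongrightarrow> 0) (at (0::real))"
      by simp
    then have "(profile \<delta> \<longlongrightarrow> 0) (at 0)"
      using le profile_bounds
      by (intro tendsto_sandwich[of "\<lambda>_. 0" "profile \<delta>" _ "\<lambda>\<xi>. exp 1 * \<bar>\<xi>\<bar> powr (1 / \<delta>)"]) auto
    then show ?thesis using True by (simp add: isCont_def profile_def)
  qed
qed

text \<open>With \<open>z = \<xi> powr (- (1 / \<delta>))\<close> the logarithm is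
  \<open>ln 2 - 1 + z\<close>, and \<open>z powr \<delta> = 1 / \<xi>\<close>. The upper limit on
  \<xi> means \<open>z \<ge> 2\<close>, so \<open>z / 2\<close> absorbs the constant; halving
  \<open>z\<close> costs the factor \<open>2 powr (- \<delta>)\<close>.\<close>

lemma profile_log:
  assumes \<delta>: "\<delta> > 0" and "0 < \<xi>" "\<xi> \<le> min 1 (2 powr (- \<delta>))"
  shows "2 powr (- \<delta>) / \<xi> \<le> \<bar>ln (2 / profile \<delta> \<xi>)\<bar> powr \<delta>"
proof -
  define z where "z = \<xi> powr (- (1 / \<delta>))"
  have "(2 powr (- \<delta>)) powr (- (1 / \<delta>)) \<le> z"
    unfolding z_def using assms \<delta> by (intro powr_mono2') auto
  then have z: "z \<ge> 2" using \<delta> by (simp add: powr_powr)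
  then have p: "profile \<delta> \<xi> = exp (1 - z)"
    using assms by (simp add: profile_def z_def min_def)
  have "ln (2 / profile \<delta> \<xi>) = ln 2 - 1 + z" by (simp add: p ln_div)
  moreover have "ln (2::real) > 0" by simp
  ultimately have "z / 2 \<le> \<bar>ln (2 / profile \<delta> \<xi>)\<bar>" using z by linarith
  then have "(z / 2) powr \<delta> \<le> \<bar>ln (2 / profile \<delta> \<xi>)\<bar> powr \<delta>"
    using z \<delta> by (intro powr_mono2) auto
  moreover have "z powr \<delta> = 1 / \<xi>"
    unfolding z_def powr_powr using assms \<delta> by (simp add: powr_minus_divide)
  then have "(z / 2) powr \<delta> = 2 powr (- \<delta>) / \<xi>"
    using z by (simp add: powr_divide powr_minus_divide mult.commute)
  ultimately show ?thesis by simp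
qed

text \<open>Supplies \<open>B0\<close>: equal to 1 near the singularity and corrected further out so
  that the final velocity, a multiple of this primitive, vanishes beyond 4.\<close>

lemma balanced_slope_exists:
  fixes A :: "real \<Rightarrow> real"
  assumes c: "continuous_on UNIV A" and even: "\<And>\<xi>. A (- \<xi>) = A \<xi>" and outer: "\<And>\<xi>. \<bar>\<xi>\<bar> \<ge> 1 \<Longrightarrow> A \<xi> = 1"
    and nonneg: "\<And>\<xi>. A \<xi> \<ge> 0"
  shows "\<exists>b C. continuous_on UNIV b \<and> (\<forall>\<xi>. b (- \<xi>) = b \<xi>) \<and> (\<forall>\<xi>. \<bar>\<xi>\<bar> \<le> 1 \<longrightarrow> b \<xi> = 1) \<and>
    (\<forall>\<xi>. \<bar>b \<xi>\<bar> \<le> C) \<and> (\<forall>\<xi>. \<bar>\<xi>\<bar> \<ge> 4 \<longrightarrow> b \<xi> = 0) \<and>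
    (\<forall>\<xi>. \<bar>\<xi>\<bar> \<ge> 4 \<longrightarrow> prim (\<lambda>\<eta>. A \<eta> * b \<eta>) \<xi> = 0)"
proof -
  \<comment> \<open>\<open>f\<close> is the plateau. The bumps \<open>g\<close> sit on
    \<open>2 < |\<xi>| < 4\<close>, disjoint from \<open>{-1..1}\<close> and inside the region where
    \<open>A\<close> is 1, so their weighted integral is positive.\<close>
  define f g where "f \<xi> = max 0 (min 1 (2 - \<bar>\<xi>\<bar>))" and "g \<xi> = max 0 (1 - \<bar>\<bar>\<xi>\<bar> - 3\<bar>)" for \<xi> :: real
  have cf: "continuous_on UNIV f" and cg: "continuous_on UNIV g"
    unfolding f_def g_def by (intro continuous_intros)+
  have cA: "continuous_on UNIV (\<lambda>\<eta>. A \<eta> * f \<eta>)" "continuous_on UNIV (\<lambda>\<eta>. A \<eta> * g \<eta>)"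
    by (intro continuous_intros c cf cg)+
  \<comment> \<open>The amount of \<open>g\<close> that balances \<open>f\<close> over
    \<open>{0..4}\<close>.\<close>
  define \<gamma> where "\<gamma> = prim (\<lambda>\<eta>. A \<eta> * f \<eta>) 4 / prim (\<lambda>\<eta>. A \<eta> * g \<eta>) 4"
  define b where "b \<xi> = f \<xi> - \<gamma> * g \<xi>" for \<xi>
  have cb: "continuous_on UNIV b" unfolding b_def by (intro continuous_intros cf cg)
  have cAb: "continuous_on UNIV (\<lambda>\<eta>. A \<eta> * b \<eta>)" by (intro continuous_intros c cb)
  have pg: "prim (\<lambda>\<eta>. A \<eta> * g \<eta>) 4 > 0"
  proof -
    have "prim (\<lambda>\<eta>. A \<eta> * g \<eta>) 0 \<le> prim (\<lambda>\<eta>. A \<eta> * g \<eta>) 2"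
    proof (rule DERIV_nonneg_imp_nondecreasing, simp, intro exI conjI)
      show "A x * g x \<ge> 0" for x using nonneg by (simp add: g_def)
    qed (rule has_real_derivative_prim[OF cA(2)])
    also have "\<dots> < prim (\<lambda>\<eta>. A \<eta> * g \<eta>) 4"
    proof (rule DERIV_pos_imp_increasing_open, simp, intro exI conjI)
      fix x :: real assume "2 < x" "x < 4"
      then show "A x * g x > 0" using outer[of x] by (auto simp: g_def)
    next
      show "continuous_on {2..4} (prim (\<lambda>\<eta>. A \<eta> * g \<eta>))"
        by (rule continuous_on_prim[OF cA(2)])
    qed (rule has_real_derivative_prim[OF cA(2)])
    finally show ?thesis by simp
  qed
  have "prim (\<lambda>\<eta>. A \<eta> * b \<eta>) \<xi> = prim (\<lambda>\<eta>. A \<eta> * f \<eta>) \<xi> - \<gamma> * prim (\<lambda>\<eta>. A \<eta> * g \<eta>) \<xi>" for \<xi>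
    by (subst prim_eq[where F = "\<lambda>\<xi>. prim (\<lambda>\<eta>. A \<eta> * f \<eta>) \<xi> - \<gamma> * prim (\<lambda>\<eta>. A \<eta> * g \<eta>) \<xi>"])
      (auto intro!: derivative_eq_intros has_real_derivative_prim cA simp: b_def algebra_simps)
  then have four: "prim (\<lambda>\<eta>. A \<eta> * b \<eta>) 4 = 0" using pg by (simp add: \<gamma>_def)
  have zero: "b \<xi> = 0" if "\<bar>\<xi>\<bar> \<ge> 4" for \<xi> using that by (auto simp: b_def f_def g_def)
  have b_even: "b (- \<xi>) = b \<xi>" for \<xi> by (simp add: b_def f_def g_def)
  have right: "prim (\<lambda>\<eta>. A \<eta> * b \<eta>) \<xi> = 0" if "\<xi> \<ge> 4" for \<xi>
  proof -
    have "\<bar>prim (\<lambda>\<eta>. A \<eta> * b \<eta>) \<xi> - prim (\<lambda>\<eta>. A \<eta> * b \<eta>) 4\<bar> \<le> 0 * \<bar>\<xi> - 4\<bar>"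
    proof (rule interior_derivative_bound[where a = 4 and b = \<xi> and f' = "\<lambda>_. 0"])
      show "(prim (\<lambda>\<eta>. A \<eta> * b \<eta>) has_real_derivative 0) (at x)" if "4 < x" for x
        using has_real_derivative_prim[OF cAb, of x] zero[of x] that by simp
      show "continuous_on {4..\<xi>} (prim (\<lambda>\<eta>. A \<eta> * b \<eta>))"
        by (rule continuous_on_prim[OF cAb])
    qed (use that in auto)
    then show ?thesis by (simp add: four)
  qed
  show ?thesis
  proof (intro exI[of _ b] exI[of _ "1 + \<bar>\<gamma>\<bar>"] conjI allI impI)
    show "\<bar>b \<xi>\<bar> \<le> 1 + \<bar>\<gamma>\<bar>" for \<xi>
    proof -
      have "\<bar>b \<xi>\<bar> \<le> \<bar>f \<xi>\<bar> + \<bar>\<gamma>\<bar> * \<bar>g \<xi>\<bar>" unfolding b_def abs_mult[symmetric] by (rule abs_triangle_ineq4)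
      also have "\<dots> \<le> 1 + \<bar>\<gamma>\<bar> * 1" by (intro add_mono mult_left_mono) (auto simp: f_def g_def)
      finally show ?thesis by simp
    qed
    show "prim (\<lambda>\<eta>. A \<eta> * b \<eta>) \<xi> = 0" if "\<bar>\<xi>\<bar> \<ge> 4" for \<xi>
      using right[of \<xi>] right[of "- \<xi>"] that prim_uminus[OF cAb, of \<xi>]
      by (cases "\<xi> \<ge> 0") (auto simp: even b_even)
    show "b \<xi> = 1" if "\<bar>\<xi>\<bar> \<le> 1" for \<xi> using that by (auto simp: b_def f_def g_def)
  qed (use cb zero b_even in auto)
qed

theorem theorem8p2:
  fixes l \<delta> :: real
  assumes "l > 0" and "\<delta> > 0"
  shows "\<exists>(u\<^sub>0 :: real \<Rightarrow> real) (T :: real) (K :: real set).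
    u\<^sub>0 \<in> H1 \<inter> W1inf \<and> T > 0 \<and> compact K \<and>
    (\<exists>u :: real \<Rightarrow> real \<Rightarrow> real.
       rB_solution l T u \<and> (AE x in lborel. u 0 x = u\<^sub>0 x) \<and>
       (\<exists>v\<^sub>0 \<in> borel_measurable borel. has_weak_deriv u\<^sub>0 v\<^sub>0 \<and>
          (\<integral>\<^sup>+x. ennreal ((v\<^sub>0 x)\<^sup>2 * log_weight \<delta> (v\<^sub>0 x)) \<partial>lborel) < \<infinity>) \<and>
       (\<exists>v\<^sub>T \<in> borel_measurable borel. has_weak_deriv (u T) v\<^sub>T \<and>
          (\<integral>\<^sup>+x\<in>K. ennreal ((v\<^sub>T x)\<^sup>2 * log_weight \<delta> (v\<^sub>T x)) \<partial>lborel) = \<infinity>))"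
proof -
  note p = profile_cont[OF assms(2)] profile_even profile_bounds profile_outer[OF assms(2)]
  obtain b C where b: "continuous_on UNIV b" "\<And>\<xi>. b (- \<xi>) = b \<xi>" "\<And>\<xi>. \<bar>\<xi>\<bar> \<le> 1 \<Longrightarrow> b \<xi> = 1"
    "\<And>\<xi>. \<bar>b \<xi>\<bar> \<le> C" "\<And>\<xi>. \<bar>\<xi>\<bar> \<ge> 4 \<Longrightarrow> b \<xi> = 0"
    "\<And>\<xi>. \<bar>\<xi>\<bar> \<ge> 4 \<Longrightarrow> prim (\<lambda>\<eta>. profile \<delta> \<eta> * b \<eta>) \<xi> = 0"
    using balanced_slope_exists[OF p(1,2,5,3)] by blast
  have "C \<ge> 0" using order_trans[OF abs_ge_zero b(4)] .
  \<comment> \<open>\<open>b\<close> lives on \<open>{-4..4}\<close>, where \<open>rho l\<close> is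
    at least \<open>rho l 4\<close>; the 1 is the room kept for \<open>adm_Phi\<close>.\<close>
  define M where "M = 1 + C / rho l 4"
  have M: "M \<ge> 1" using \<open>C \<ge> 0\<close> by (simp add: M_def)
  have b_rho: "\<bar>b \<xi>\<bar> \<le> (M - 1) * rho l \<xi>" for \<xi>
  proof (cases "\<bar>\<xi>\<bar> \<ge> 4")
    case True
    then show ?thesis using b(5) M by simp
  next
    case False
    then have "rho l 4 \<le> rho l \<xi>"
      using assms(1) unfolding rho_def exp_le_cancel_iff by (intro divide_right_mono) auto
    then have "C * 1 \<le> C * (rho l \<xi> / rho l 4)"
      using \<open>C \<ge> 0\<close> by (intro mult_left_mono) (auto simp: field_simps)
    with b(4)[of \<xi>] show ?thesis by (simp add: M_def)
  qed
  \<comment> \<open>These constants depend on \<open>l\<close> and \<open>M\<close> only, so they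
    may enter the choice of \<open>T\<close> without circularity. The denominator of
    \<open>T\<close> adds up the smallness requirements; the absolute values are there because
    nonnegativity is proved only inside the locale.\<close>
  define c1 c3 where "c1 = rB_data.C1 l M" and "c3 = rB_data.C3 l M"
  define T where "T = 1 / (2 * M + 2 * \<bar>c1\<bar> + \<bar>c3\<bar>)"
  have den: "2 * M + 2 * \<bar>c1\<bar> + \<bar>c3\<bar> > 0" using M by linarith
  have T_small: "T > 0" "T * M \<le> 1 / 2" "T * c1 \<le> 1 / 2" "T * c3 \<le> 1"
    using den M by (auto simp: T_def field_simps)
  interpret rB_data l M T "profile \<delta>" b
    by unfold_locales (use assms M T_small p b b_rho in auto)
  obtain B where "adm B" "\<And>s \<xi>. B s (- \<xi>) = B s \<xi>" "\<And>s \<xi>. B s \<xi> = Phi B s \<xi>"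
    using fixed_point_exists T_small(3,4) unfolding c1_def c3_def by blast
  then interpret rB_flow l M T "profile \<delta>" b B 4
    by unfold_locales (use T_small(3) b profile_pos in \<open>auto simp: c1_def\<close>)
  \<comment> \<open>The range on which \<open>profile_log\<close> holds, cut at 1 so that the slope
    is 1 on it.\<close>
  define e where "e = min 1 (2 powr (- \<delta>))"
  have "(\<integral>\<^sup>+x\<in>{0..Y 0 e}. ennreal ((v T x)\<^sup>2 * log_weight \<delta> (v T x)) \<partial>lborel) = \<infinity>"
    by (rule final_weight_infinite[of e "2 powr (- \<delta>)"]) (use profile_log[OF assms(2)] in \<open>auto simp: e_def\<close>)
  then show ?thesis
    using initial_spaces T_small(1) solution initial_weight_finite[OF assms(2)] weak_deriv_u v_measurable
    by (intro exI[of _ "u 0"] exI[of _ T] exI[of _ "{0..Y 0 e}"] exI[of _ u] conjI bexI[of _ "v 0"] bexI[of _ "v T"]) auto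
qed

end
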